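(* There exists an algorithm $\textsc{FindRegularCoefficients}(\varepsilon,d,H,\mathbf v_{\mathrm{head}},\tau,D)$ that takes as inputs $\varepsilon\in(0,1)$, a positive integer $d$, a set $H\subset[d]$, a vector $\mathbf v_{\mathrm{head}}\in\mathbb{R}^d$ supported on $H$, a value $\tau\in\mathbb{R}$, and sample access to a distribution $D$ supported on $\{\pm1\}^d\times\{\pm1\}$ whose $\{\pm1\}^d$-marginal is uniform. The algorithm runs in time $\mathrm{poly}(d/\varepsilon)$ and outputs, with probability at least $0.995$, a vector $\widehat{\mathbf v}\in\mathbb{R}^d$ with \[ \Pr_{(\mathbf x,y)\sim D}\big[\mathrm{sign}(\widehat{\mathbf v}\cdot\mathbf x+\tau)\neq y\big]\leq O\Big(\frac{\mathrm{opt}_{\mathrm{reg}}}{\varepsilon}\log\frac{1}{\varepsilon}+\varepsilon\Big), \] where, with $\mathcal V(H,\varepsilon)=\{\mathbf v\in\mathbb{R}^d:\|\mathbf v\|_2=1,\ \|\mathbf v\|_4^2\le\varepsilon,\ \mathbf v_H=0\}$, \[ \mathrm{opt}_{\mathrm{reg}}=\min_{\mathbf v\in\mathcal V(H,\varepsilon)}\Pr_{(\mathbf x,y)\sim D}\big[\mathrm{sign}(\mathbf v_{\mathrm{head}}\cdot\mathbf x+\mathbf v\cdot\mathbf x+\tau)\neq y\big]. \]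
   Context: $\mathbf v_H$ denotes the restriction of $\mathbf v$ to the coordinates in $H$; "supported on $H$" means all coordinates outside $H$ are zero. $\mathrm{sign}:\mathbb{R}\to\{\pm1\}$ is the sign function. *)

theory Defs
  imports "HOL-Probability.Probability" "HOL-Computational_Algebra.Polynomial"
begin

section \<open>Vectors, halfspaces and the regular optimum\<close>

text \<open>The index set \<open>[d]\<close> is \<open>{..<d}\<close>. Since \<open>d\<close> is an input of the algorithm, a vector of
  \<open>\<real>\<^sup>d\<close> is a function on \<open>nat\<close> that vanishes outside \<open>{..<d}\<close>.\<close>

definition Rd :: "nat \<Rightarrow> (nat \<Rightarrow> real) set" where
  "Rd d = {v. \<forall>i\<ge>d. v i = 0}"

definition dotp :: "nat \<Rightarrow> (nat \<Rightarrow> real) \<Rightarrow> (nat \<Rightarrow> real) \<Rightarrow> real" where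
  "dotp d v x = (\<Sum>i<d. v i * x i)"

definition pnorm :: "nat \<Rightarrow> nat \<Rightarrow> (nat \<Rightarrow> real) \<Rightarrow> real" where
  "pnorm d p v = root p (\<Sum>i<d. \<bar>v i\<bar> ^ p)"

definition cube :: "nat \<Rightarrow> (nat \<Rightarrow> real) set" where
  "cube d = PiE_dflt {..<d} 0 (\<lambda>_. {-1, 1})"

text \<open>Unlike the library's \<^const>\<open>sgn\<close>, the sign takes only the values \<open>-1\<close> and \<open>1\<close>;
  the sign of \<open>0\<close> is \<open>1\<close>.\<close>

definition sign :: "real \<Rightarrow> real" where
  "sign t = (if t \<ge> 0 then 1 else -1)"

definition err :: "((nat \<Rightarrow> real) \<times> real) pmf \<Rightarrow> ((nat \<Rightarrow> real) \<Rightarrow> real) \<Rightarrow> real" where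
  "err D f = measure_pmf.prob D {(x, y). sign (f x) \<noteq> y}"

definition regular_vecs :: "nat \<Rightarrow> nat set \<Rightarrow> real \<Rightarrow> (nat \<Rightarrow> real) set" where
  "regular_vecs d H \<epsilon> =
     {v \<in> Rd d. pnorm d 2 v = 1 \<and> (pnorm d 4 v)\<^sup>2 \<le> \<epsilon> \<and> (\<forall>i\<in>H. v i = 0)}"

text \<open>The minimum is an infimum in the extended reals, so that it is \<open>\<infinity>\<close> if there is no regular
  vector at all; otherwise it is attained (lemma \<open>opt_reg_attained\<close>).\<close>

definition opt_reg ::
  "nat \<Rightarrow> nat set \<Rightarrow> real \<Rightarrow> (nat \<Rightarrow> real) \<Rightarrow> real \<Rightarrow> ((nat \<Rightarrow> real) \<times> real) pmf \<Rightarrow> ereal" where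
  "opt_reg d H \<epsilon> vhead \<tau> D =
     (INF v \<in> regular_vecs d H \<epsilon>. ereal (err D (\<lambda>x. dotp d vhead x + dotp d v x + \<tau>)))"

lemma finite_cube: "finite (cube d)"
  unfolding cube_def by (intro finite_PiE_dflt) auto

lemma opt_reg_attained:
  assumes "set_pmf D \<subseteq> cube d \<times> {-1, 1}" and "regular_vecs d H \<epsilon> \<noteq> {}"
  shows "\<exists>v\<in>regular_vecs d H \<epsilon>.
           opt_reg d H \<epsilon> vhead \<tau> D = ereal (err D (\<lambda>x. dotp d vhead x + dotp d v x + \<tau>))"
proof -
  let ?e = "\<lambda>v. err D (\<lambda>x. dotp d vhead x + dotp d v x + \<tau>)"
  let ?E = "(\<lambda>v. ereal (?e v)) ` regular_vecs d H \<epsilon>"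
  have fin: "finite (set_pmf D)"
    by (rule finite_subset[OF assms(1)]) (simp add: finite_cube)
  have "?E \<subseteq> (\<lambda>A. ereal (measure_pmf.prob D A)) ` Pow (set_pmf D)"
  proof
    fix r assume "r \<in> ?E"
    then obtain v where r: "r = ereal (?e v)" by auto
    let ?A = "{(x, y). sign (dotp d vhead x + dotp d v x + \<tau>) \<noteq> y}"
    have "?e v = measure_pmf.prob D (?A \<inter> set_pmf D)"
      unfolding err_def by (rule measure_Int_set_pmf[symmetric])
    then show "r \<in> (\<lambda>A. ereal (measure_pmf.prob D A)) ` Pow (set_pmf D)"
      using r by blast
  qed
  then have "finite ?E" by (rule finite_subset) (simp add: fin)
  moreover have "?E \<noteq> {}" using assms(2) by simp
  ultimately have "Inf ?E \<in> ?E" using Min_Inf[of ?E] Min_in[of ?E] by simp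
  then obtain v where "v \<in> regular_vecs d H \<epsilon>" "Inf ?E = ereal (?e v)" by (elim imageE)
  then show ?thesis unfolding opt_reg_def by (intro bexI[of _ v])
qed

section \<open>Randomised real RAM with sample access\<close>

text \<open>The inputs are arbitrary real vectors and the time bound depends only on \<open>d / \<epsilon>\<close>, so time is
  counted in the real RAM model: exact real arithmetic, at unit cost, restricted to the field
  operations and comparisons. In particular there is no rounding of reals to integers, which would
  make unit-cost arithmetic unreasonably powerful, and program
  constants are rational, as arbitrary real constants could encode non-computable information. Integer
  registers serve as counters and array indices and have no multiplication.

  A program is a finite term that refers to finitely many integer registers and real arrays.
  Its expressions have constant size, so it is immaterial that a command costs one step
  regardless of the expressions in it. Division by zero yields \<open>0\<close>.\<close>

datatype iexp = IConst nat | IReg nat | IAdd iexp iexp | ISub iexp iexp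

datatype rexp =
    RConst rat
  | RCell nat iexp  \<comment> \<open>array name and index\<close>
  | ROfInt iexp
  | RAdd rexp rexp | RSub rexp rexp | RMul rexp rexp | RDiv rexp rexp

datatype bexp = ILe iexp iexp | RLe rexp rexp | BNot bexp | BAnd bexp bexp

datatype com =
    Skip
  | ISet nat iexp
  | RSet nat iexp rexp
  | Flip nat  \<comment> \<open>put a fair random bit into an integer register\<close>
  | Sample nat nat
      \<comment> \<open>\<open>Sample a b\<close> draws a fresh example \<open>(x, y)\<close> and stores \<open>x\<close> in array \<open>a\<close>, \<open>y\<close> in cell 0 of \<open>b\<close>\<close>
  | Seq com com
  | Cond bexp com com
  | While bexp com

record state =
  ireg :: "nat \<Rightarrow> nat"
  arr :: "nat \<Rightarrow> nat \<Rightarrow> real"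

primrec ival :: "iexp \<Rightarrow> state \<Rightarrow> nat" where
  "ival (IConst n) s = n"
| "ival (IReg r) s = ireg s r"
| "ival (IAdd e f) s = ival e s + ival f s"
| "ival (ISub e f) s = ival e s - ival f s"

primrec rval :: "rexp \<Rightarrow> state \<Rightarrow> real" where
  "rval (RConst q) s = of_rat q"
| "rval (RCell a e) s = arr s a (ival e s)"
| "rval (ROfInt e) s = real (ival e s)"
| "rval (RAdd e f) s = rval e s + rval f s"
| "rval (RSub e f) s = rval e s - rval f s"
| "rval (RMul e f) s = rval e s * rval f s"
| "rval (RDiv e f) s = rval e s / rval f s"

primrec bval :: "bexp \<Rightarrow> state \<Rightarrow> bool" where
  "bval (ILe e f) s = (ival e s \<le> ival f s)"
| "bval (RLe e f) s = (rval e s \<le> rval f s)"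
| "bval (BNot b) s = (\<not> bval b s)"
| "bval (BAnd b c) s = (bval b s \<and> bval c s)"

definition set_ireg :: "nat \<Rightarrow> nat \<Rightarrow> state \<Rightarrow> state" where
  "set_ireg r n s = s\<lparr>ireg := (ireg s)(r := n)\<rparr>"

definition set_arr :: "nat \<Rightarrow> (nat \<Rightarrow> real) \<Rightarrow> state \<Rightarrow> state" where
  "set_arr a x s = s\<lparr>arr := (arr s)(a := x)\<rparr>"

definition set_cell :: "nat \<Rightarrow> nat \<Rightarrow> real \<Rightarrow> state \<Rightarrow> state" where
  "set_cell a i r s = set_arr a ((arr s a)(i := r)) s"

text \<open>A configuration is a stack of commands still to be executed, together with the memory;
  it is halted if the stack is empty. Drawing an example is one step; charging it \<open>d\<close> steps
  instead would multiply running times by at most \<open>d\<close>.\<close>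

type_synonym config = "com list \<times> state"

fun step :: "((nat \<Rightarrow> real) \<times> real) pmf \<Rightarrow> config \<Rightarrow> config pmf" where
  "step D ([], s) = return_pmf ([], s)"
| "step D (Skip # k, s) = return_pmf (k, s)"
| "step D (ISet r e # k, s) = return_pmf (k, set_ireg r (ival e s) s)"
| "step D (RSet a i e # k, s) = return_pmf (k, set_cell a (ival i s) (rval e s) s)"
| "step D (Flip r # k, s) =
     map_pmf (\<lambda>c. (k, set_ireg r (of_bool c) s)) (bernoulli_pmf (1/2))"
| "step D (Sample a b # k, s) =
     map_pmf (\<lambda>(x, y). (k, set_cell b 0 y (set_arr a x s))) D"
| "step D (Seq c1 c2 # k, s) = return_pmf (c1 # c2 # k, s)"
| "step D (Cond b c1 c2 # k, s) = return_pmf ((if bval b s then c1 else c2) # k, s)"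
| "step D (While b c # k, s) = return_pmf (if bval b s then c # While b c # k else k, s)"

primrec steps :: "((nat \<Rightarrow> real) \<times> real) pmf \<Rightarrow> nat \<Rightarrow> config \<Rightarrow> config pmf" where
  "steps D 0 cfg = return_pmf cfg"
| "steps D (Suc n) cfg = bind_pmf (step D cfg) (steps D n)"

text \<open>Calling convention: integer register 0 holds \<open>d\<close>; array 0 holds \<open>\<epsilon>\<close> and \<open>\<tau>\<close>; array 1 holds
  the indicator vector of \<open>H\<close>; array 2 holds the head vector; everything else is zero.
  The output is read from array 3.\<close>

definition init_state :: "real \<Rightarrow> nat \<Rightarrow> nat set \<Rightarrow> (nat \<Rightarrow> real) \<Rightarrow> real \<Rightarrow> state" where
  "init_state \<epsilon> d H vhead \<tau> =
     \<lparr>ireg = (\<lambda>_. 0)(0 := d),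
      arr = (\<lambda>_ _. 0)(0 := (\<lambda>_. 0)(0 := \<epsilon>, 1 := \<tau>), 1 := indicator H, 2 := vhead)\<rparr>"

definition out_vec :: "nat \<Rightarrow> config \<Rightarrow> nat \<Rightarrow> real" where
  "out_vec d cfg = (\<lambda>i. if i < d then arr (snd cfg) 3 i else 0)"

definition run ::
  "com \<Rightarrow> real \<Rightarrow> nat \<Rightarrow> nat set \<Rightarrow> (nat \<Rightarrow> real) \<Rightarrow> real \<Rightarrow> ((nat \<Rightarrow> real) \<times> real) pmf
    \<Rightarrow> nat \<Rightarrow> config pmf" where
  "run P \<epsilon> d H vhead \<tau> D T = steps D T ([P], init_state \<epsilon> d H vhead \<tau>)"

definition halted :: "config \<Rightarrow> bool" where
  "halted cfg \<longleftrightarrow> fst cfg = []"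

end

theory Submission imports Defs begin

text \<open>The learner runs stochastic gradient descent on the hinge loss
  \<open>max 0 (1 - y (t + w \<bullet> x) / \<epsilon>)\<close> with margin \<open>\<epsilon>\<close>, where \<open>t = v_head \<bullet> x + \<tau>\<close>, restricted to the band
  \<open>\<bar>t\<bar> \<le> K\<close> with \<open>K\<close> of order \<open>log (1/\<epsilon>)\<close>; outside the band no vector of bounded norm changes the
  sign of \<open>t\<close>, except with probability \<open>O(\<epsilon>)\<close>. The hinge loss dominates the classification error.
  Conversely, the hinge loss of the optimal regular \<open>v\<close> is at most \<open>O(opt K / \<epsilon> + \<epsilon>)\<close>: misclassified
  points cost \<open>O(K / \<epsilon>)\<close> each, and correctly classified ones cost something only if
  \<open>\<bar>t + v \<bullet> x\<bar> \<le> \<epsilon>\<close>. By Esseen's inequality this has probability \<open>O(\<epsilon>)\<close>, because regularity makes the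
  characteristic function decay like a Gaussian one up to frequency \<open>1/\<epsilon>\<close>. Since constant factors are
  allowed, Markov's inequality turns the regret bound in expectation into the probability \<open>0.995\<close>.\<close>

section \<open>Tails and small balls for Rademacher sums\<close>

text \<open>The uniform measure on the cube is a product of fair signs, so the last coordinate can
  be averaged separately.\<close>

lemma expectation_cube_Suc:
  fixes f :: "(nat \<Rightarrow> real) \<Rightarrow> real"
  shows "measure_pmf.expectation (pmf_of_set (cube (Suc d))) f =
    (measure_pmf.expectation (pmf_of_set (cube d)) (\<lambda>x. f (x(d := -1)))
      + measure_pmf.expectation (pmf_of_set (cube d)) (\<lambda>x. f (x(d := 1)))) / 2"
proof -
  have P: "pmf_of_set (cube n) = Pi_pmf {..<n} 0 (\<lambda>_. pmf_of_set {-1, 1})" for n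
    unfolding cube_def by (rule Pi_pmf_of_set[symmetric]) auto
  have ne: "cube d \<noteq> {}"
    unfolding cube_def by (auto simp: PiE_dflt_empty_iff)
  have "pmf_of_set (cube (Suc d)) =
      pmf_of_set {-1, 1} \<bind> (\<lambda>y. map_pmf (\<lambda>x. x(d := y)) (pmf_of_set (cube d)))"
    unfolding P lessThan_Suc by (subst Pi_pmf_insert') (auto simp: map_pmf_def)
  then show ?thesis
    by (simp add: pmf_expectation_bind_pmf_of_set ne finite_cube field_simps)
qed

lemma dotp_fun_upd_Suc [simp]: "dotp (Suc d) u (x(d := y)) = dotp d u x + u d * y"
  by (simp add: dotp_def)

text \<open>Real part of a characteristic function: the sine terms cancel between the two values of
  each coordinate. The phase \<open>b\<close> is free because the induction absorbs the last
  coordinate into it.\<close>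

lemma expectation_cube_cos:
  "measure_pmf.expectation (pmf_of_set (cube d)) (\<lambda>x. cos (b + dotp d u x))
    = cos b * (\<Prod>i<d. cos (u i))"
proof (induction d arbitrary: b)
  case 0
  then show ?case by (simp add: dotp_def)
next
  case (Suc d)
  have eq: "(\<lambda>x. cos (b + (dotp d u x + c))) = (\<lambda>x. cos ((b + c) + dotp d u x))" for c
    by (simp add: algebra_simps)
  show ?case
    unfolding expectation_cube_Suc dotp_fun_upd_Suc eq Suc.IH
    by (simp add: cos_add cos_diff field_simps)
qed

text \<open>Hoeffding's lemma for a fair sign, whose moment generating function is
  \<open>cosh\<close>; factoring out \<open>exp (- u)\<close> gives its form with probability 1/2
  and parameter \<open>2 * u\<close>.\<close>

lemma cosh_le_exp_square: "cosh (u :: real) \<le> exp (u\<^sup>2 / 2)"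
proof -
  have *: "cosh u \<le> exp (u\<^sup>2 / 2)" if "u \<ge> 0" for u :: real
  proof -
    have pos: "0 < 1 + (1/2) * (exp (2 * u) - 1)"
      using exp_gt_zero[of "2 * u"] by (simp add: field_simps del: exp_gt_zero)
    have "cosh u = exp (- u) * (1 + (1/2) * (exp (2 * u) - 1))"
      by (simp add: cosh_field_def algebra_simps mult_exp_exp)
    also have "\<dots> = exp (- (2 * u) * (1/2) + ln (1 + (1/2) * (exp (2 * u) - 1)))"
      using pos by (simp only: exp_add exp_ln) simp
    also have "\<dots> \<le> exp ((2 * u)\<^sup>2 / 8)"
      using Hoeffdings_lemma_aux[of "2 * u" "1/2"] that by simp
    finally show ?thesis by (simp add: power_mult_distrib)
  qed
  show ?thesis using *[of u] *[of "-u"] by (cases "u \<ge> 0") auto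
qed

lemma expectation_cube_exp_le:
  "measure_pmf.expectation (pmf_of_set (cube d)) (\<lambda>x. exp (dotp d u x))
    \<le> exp ((\<Sum>i<d. (u i)\<^sup>2) / 2)"
proof -
  have "measure_pmf.expectation (pmf_of_set (cube d)) (\<lambda>x. exp (dotp d u x)) = (\<Prod>i<d. cosh (u i))"
  proof (induction d)
    case 0
    then show ?case by (simp add: dotp_def)
  next
    case (Suc d)
    have eq: "exp (dotp d u x + c) = exp c * exp (dotp d u x)" for x c
      by (simp add: exp_add)
    show ?case
      unfolding expectation_cube_Suc dotp_fun_upd_Suc eq integral_mult_right_zero Suc.IH
      by (simp add: cosh_field_def algebra_simps add_divide_distrib)
  qed
  also have "\<dots> \<le> (\<Prod>i<d. exp ((u i)\<^sup>2 / 2))"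
    by (intro prod_mono conjI cosh_le_exp_square) (simp add: cosh_real_nonneg)
  also have "\<dots> = exp ((\<Sum>i<d. (u i)\<^sup>2) / 2)"
    by (simp add: exp_sum sum_divide_distrib)
  finally show ?thesis .
qed

lemma integrable_cube [simp]:
  fixes f :: "_ \<Rightarrow> real"
  shows "integrable (measure_pmf (pmf_of_set (cube d))) f"
proof -
  have "cube d \<noteq> {}" unfolding cube_def by (auto simp: PiE_dflt_empty_iff)
  then show ?thesis by (intro integrable_measure_pmf_finite) (simp add: finite_cube)
qed

text \<open>\<open>exp (l * |z|)\<close> is at most \<open>exp (l * z) + exp (- l * z)\<close>, and
  both terms obey the subgaussian bound.\<close>

lemma expectation_cube_exp_abs_le:
  assumes "(\<Sum>i<d. (u i)\<^sup>2) \<le> r"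
  shows "measure_pmf.expectation (pmf_of_set (cube d)) (\<lambda>x. exp (l * \<bar>dotp d u x\<bar>))
    \<le> 2 * exp (l\<^sup>2 * r / 2)"
proof -
  have b: "measure_pmf.expectation (pmf_of_set (cube d)) (\<lambda>x. exp (c * dotp d u x))
      \<le> exp (l\<^sup>2 * r / 2)" if "c\<^sup>2 = l\<^sup>2" for c
  proof -
    have "(\<lambda>x. c * dotp d u x) = dotp d (\<lambda>i. c * u i)"
      by (auto simp: dotp_def sum_distrib_left mult.assoc)
    then have "measure_pmf.expectation (pmf_of_set (cube d)) (\<lambda>x. exp (c * dotp d u x))
        \<le> exp ((\<Sum>i<d. (c * u i)\<^sup>2) / 2)"
      using expectation_cube_exp_le[of d "\<lambda>i. c * u i"] by metis
    also have "(\<Sum>i<d. (c * u i)\<^sup>2) = l\<^sup>2 * (\<Sum>i<d. (u i)\<^sup>2)"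
      by (simp add: power_mult_distrib that sum_distrib_left)
    also have "\<dots> \<le> l\<^sup>2 * r" using assms by (intro mult_left_mono) auto
    finally show ?thesis by simp
  qed
  have "measure_pmf.expectation (pmf_of_set (cube d)) (\<lambda>x. exp (l * \<bar>dotp d u x\<bar>))
      \<le> measure_pmf.expectation (pmf_of_set (cube d))
          (\<lambda>x. exp (l * dotp d u x) + exp (- l * dotp d u x))"
    by (intro integral_mono) (auto simp: abs_if)
  also have "\<dots> = measure_pmf.expectation (pmf_of_set (cube d)) (\<lambda>x. exp (l * dotp d u x))
      + measure_pmf.expectation (pmf_of_set (cube d)) (\<lambda>x. exp (- l * dotp d u x))"
    by (intro Bochner_Integration.integral_add) auto
  also have "\<dots> \<le> 2 * exp (l\<^sup>2 * r / 2)"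
    using b[of l] b[of "-l"] by simp
  finally show ?thesis .
qed

section \<open>Exponential tails\<close>

text \<open>Chernoff's method with exponent 1. Exponential decay suffices, since \<open>B\<close>
  will be at least \<open>ln (1 / \<epsilon>)\<close>.\<close>

lemma cube_tail:
  assumes "(\<Sum>i<d. (u i)\<^sup>2) \<le> r"
  shows "measure_pmf.prob (pmf_of_set (cube d)) {x. \<bar>dotp d u x\<bar> > B} \<le> 2 * exp (r / 2 - B)"
proof -
  have "measure_pmf.prob (pmf_of_set (cube d)) {x. \<bar>dotp d u x\<bar> > B}
      = measure_pmf.expectation (pmf_of_set (cube d)) (indicator {x. \<bar>dotp d u x\<bar> > B})"
    by simp
  also have "\<dots> \<le> measure_pmf.expectation (pmf_of_set (cube d))
      (\<lambda>x. exp (- B) * exp (1 * \<bar>dotp d u x\<bar>))"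
    by (intro integral_mono) (auto simp: indicator_def simp flip: exp_add)
  also have "\<dots> \<le> exp (- B) * (2 * exp (1\<^sup>2 * r / 2))"
    unfolding integral_mult_right_zero by (intro mult_left_mono expectation_cube_exp_abs_le assms) auto
  also have "\<dots> = 2 * exp (r / 2 - B)" by (simp add: mult_exp_exp algebra_simps)
  finally show ?thesis .
qed

text \<open>The rate \<open>2 * B\<close> matters: this tail is later divided by \<epsilon>, and
  \<open>exp (- 2 * B)\<close> still leaves a factor \<epsilon>.\<close>

lemma cube_tail_expectation:
  assumes "(\<Sum>i<d. (u i)\<^sup>2) \<le> r"
  shows "measure_pmf.expectation (pmf_of_set (cube d))
      (\<lambda>x. \<bar>dotp d u x\<bar> * indicator {x. \<bar>dotp d u x\<bar> > B} x) \<le> 2 * exp (9 * r / 2 - 2 * B)"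
proof -
  \<comment> \<open>For \<open>z > B\<close>, \<open>z\<close> is at most \<open>exp z\<close>, and
    \<open>exp (2 * (z - B))\<close> is at least 1.\<close>
  have pw: "z * (if z > B then 1 else 0) \<le> exp (- 2 * B) * exp (3 * z)" if "z \<ge> 0" for z :: real
  proof (cases "z > B")
    case True
    have "z \<le> exp z" using exp_ge_add_one_self[of z] by linarith
    also have "\<dots> \<le> exp (- 2 * B + 3 * z)" using True by simp
    finally show ?thesis using True by (simp add: mult_exp_exp)
  qed auto
  have "measure_pmf.expectation (pmf_of_set (cube d))
        (\<lambda>x. \<bar>dotp d u x\<bar> * indicator {x. \<bar>dotp d u x\<bar> > B} x)
      \<le> measure_pmf.expectation (pmf_of_set (cube d))
        (\<lambda>x. exp (- 2 * B) * exp (3 * \<bar>dotp d u x\<bar>))"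
  proof (intro integral_mono)
    fix x show "\<bar>dotp d u x\<bar> * indicator {x. \<bar>dotp d u x\<bar> > B} x
        \<le> exp (- 2 * B) * exp (3 * \<bar>dotp d u x\<bar>)"
      using pw[of "\<bar>dotp d u x\<bar>"] by (auto simp: indicator_def split: if_splits)
  qed auto
  also have "\<dots> \<le> exp (- 2 * B) * (2 * exp (3\<^sup>2 * r / 2))"
    unfolding integral_mult_right_zero by (intro mult_left_mono expectation_cube_exp_abs_le assms) auto
  also have "\<dots> = 2 * exp (9 * r / 2 - 2 * B)" by (simp add: mult_exp_exp algebra_simps)
  finally show ?thesis .
qed

section \<open>Anticoncentration by Fourier analysis\<close>

lemma cos_le_quartic: "cos (x :: real) \<le> 1 - x\<^sup>2 / 2 + x ^ 4 / 24"
proof -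
  obtain t where "cos x = (\<Sum>m<4. cos_coeff m * x ^ m) + (cos (t + 1/2 * real 4 * pi) / fact 4) * x ^ 4"
    using Maclaurin_cos_expansion[of x 4] by blast
  moreover have "(\<Sum>m<4. cos_coeff m * x ^ m) = 1 - x\<^sup>2 / 2"
    by (simp add: cos_coeff_def lessThan_nat_numeral fact_numeral)
  moreover have "(cos (t + 1/2 * real 4 * pi) / fact 4) * x ^ 4 \<le> (1 / fact 4) * x ^ 4"
    by (intro mult_right_mono divide_right_mono) auto
  ultimately show ?thesis by (simp add: fact_numeral)
qed

lemma sin_square_ge: "(sin (x :: real))\<^sup>2 \<ge> x\<^sup>2 - x ^ 4 / 3"
  using cos_le_quartic[of "2 * x"] by (simp add: cos_double_sin power_mult_distrib)

text \<open>Each factor is at most \<open>exp (- (sin x)^2 / 2)\<close>, and the quartic lower bound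
  on the squared sine brings in the two power sums. Up to frequency \<open>1 / \<epsilon>\<close>
  the quartic term costs at most a third of \<open>s^2\<close>.\<close>

lemma prod_cos_le:
  fixes v :: "nat \<Rightarrow> real" and s \<epsilon> :: real
  assumes n2: "(\<Sum>i<d. (v i)\<^sup>2) = 1" and n4: "(\<Sum>i<d. (v i) ^ 4) \<le> \<epsilon>\<^sup>2" and s: "\<bar>s\<bar> * \<epsilon> \<le> 1" "\<epsilon> \<ge> 0"
  shows "(\<Prod>i<d. \<bar>cos (s * v i)\<bar>) \<le> exp (- (s\<^sup>2 / 3))"
proof -
  have one: "\<bar>cos x\<bar> \<le> exp (- ((sin x)\<^sup>2 / 2))" for x :: real
  proof (rule power2_le_imp_le)
    have "\<bar>cos x\<bar>\<^sup>2 = 1 + - (sin x)\<^sup>2" by (simp add: cos_squared_eq)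
    also have "\<dots> \<le> exp (- (sin x)\<^sup>2)" by (rule exp_ge_add_one_self)
    also have "\<dots> = (exp (- ((sin x)\<^sup>2 / 2)))\<^sup>2" by (simp flip: exp_double)
    finally show "\<bar>cos x\<bar>\<^sup>2 \<le> (exp (- ((sin x)\<^sup>2 / 2)))\<^sup>2" .
  qed simp
  have "(s * s * (\<epsilon> * \<epsilon>)) \<le> 1"
  proof -
    have "(\<bar>s\<bar> * \<epsilon>)\<^sup>2 \<le> 1" unfolding abs_square_le_1 using s by (simp add: abs_mult)
    then show ?thesis by (simp add: power2_eq_square algebra_simps)
  qed
  then have s4: "s ^ 4 * \<epsilon>\<^sup>2 \<le> s\<^sup>2"
    using mult_left_mono[of "s * s * (\<epsilon> * \<epsilon>)" 1 "s * s"] by (simp add: power2_eq_square power4_eq_xxxx mult.assoc)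
  have "(2/3) * s\<^sup>2 \<le> s\<^sup>2 - s ^ 4 * \<epsilon>\<^sup>2 / 3" using s4 by simp
  also have "\<dots> \<le> s\<^sup>2 * (\<Sum>i<d. (v i)\<^sup>2) - s ^ 4 * (\<Sum>i<d. (v i) ^ 4) / 3"
    using mult_left_mono[OF n4, of "s ^ 4"] n2 by simp
  also have "\<dots> = (\<Sum>i<d. (s * v i)\<^sup>2 - (s * v i) ^ 4 / 3)"
    by (simp add: sum_subtractf power_mult_distrib sum_distrib_left sum_divide_distrib)
  also have "\<dots> \<le> (\<Sum>i<d. (sin (s * v i))\<^sup>2)"
    by (intro sum_mono sin_square_ge)
  finally have sum: "(2/3) * s\<^sup>2 \<le> (\<Sum>i<d. (sin (s * v i))\<^sup>2)" .
  have "(\<Prod>i<d. \<bar>cos (s * v i)\<bar>) \<le> (\<Prod>i<d. exp (- ((sin (s * v i))\<^sup>2 / 2)))"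
    by (intro prod_mono) (auto simp: one)
  also have "\<dots> = exp (- ((\<Sum>i<d. (sin (s * v i))\<^sup>2) / 2))"
    unfolding sum_divide_distrib sum_negf[symmetric] by (rule exp_sum[symmetric]) simp
  also have "\<dots> \<le> exp (- (s\<^sup>2 / 3))" using sum by simp
  finally show ?thesis .
qed

text \<open>The kernel is nonnegative and bounded below near \<open>0\<close>, while its Fourier transform, the
  triangular weight, has compact support.\<close>

lemma fejer_has_integral:
  fixes u :: real
  shows "((\<lambda>s. (1 - s) * cos (s * u)) has_integral (if u = 0 then 1/2 else (1 - cos u) / u\<^sup>2)) {0..1}"
proof (cases "u = 0")
  case True
  have "((\<lambda>s::real. 1 - s) has_integral ((1 - 1\<^sup>2 / 2) - (0 - 0\<^sup>2 / 2))) {0..1}"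
    by (intro fundamental_theorem_of_calculus)
       (auto intro!: derivative_eq_intros simp flip: has_real_derivative_iff_has_vector_derivative)
  then show ?thesis using True by simp
next
  case False
  let ?F = "\<lambda>s. (1 - s) * sin (s * u) / u - cos (s * u) / u\<^sup>2"
  have "((\<lambda>s. (1 - s) * cos (s * u)) has_integral (?F 1 - ?F 0)) {0..1}"
    using False
    by (intro fundamental_theorem_of_calculus)
       (auto intro!: derivative_eq_intros simp: field_simps power2_eq_square
             simp flip: has_real_derivative_iff_has_vector_derivative)
  then show ?thesis using False by (simp add: field_simps)
qed

lemma fejer_nonneg: "0 \<le> (if u = 0 then 1/2 else (1 - cos u) / (u::real)\<^sup>2)"
  by simp

text \<open>11/24 is 1/2 - 1/24, from the quartic bound on the cosine.\<close>

lemma fejer_ge: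
  assumes "\<bar>u\<bar> \<le> 1" shows "11/24 \<le> (if u = 0 then 1/2 else (1 - cos u) / (u::real)\<^sup>2)"
proof (cases "u = 0")
  case False
  have "u ^ 4 \<le> u\<^sup>2" using assms power_decreasing[of 2 4 "\<bar>u\<bar>"] by simp
  then have "11/24 * u\<^sup>2 \<le> 1 - cos u" using cos_le_quartic[of u] by simp
  then show ?thesis using False by (simp add: field_simps)
qed auto

text \<open>The Gaussian is dominated by a multiple of the Cauchy density, whose antiderivative is
  \<open>arctan\<close>; only the order \<epsilon> of the integral matters.\<close>

lemma gaussian_integral_le:
  fixes \<epsilon> :: real
  assumes "\<epsilon> > 0"
  shows "\<exists>J. ((\<lambda>s. exp (- ((s / \<epsilon>)\<^sup>2 / 3))) has_integral J) {0..1} \<and> J \<le> 6 * \<epsilon>"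
proof -
  let ?g = "\<lambda>s. exp (- ((s / \<epsilon>)\<^sup>2 / 3))"
  have "?g integrable_on {0..1}"
    by (intro integrable_continuous_real continuous_intros) (use assms in auto)
  then obtain J where J: "(?g has_integral J) {0..1}" by blast
  let ?F = "\<lambda>s. 3 * \<epsilon> * arctan (s / \<epsilon>)"
  have I: "((\<lambda>s. 3 / (1 + (s / \<epsilon>)\<^sup>2)) has_integral (?F 1 - ?F 0)) {0..1}"
    using assms
    by (intro fundamental_theorem_of_calculus)
       (auto intro!: derivative_eq_intros simp: divide_inverse simp flip: has_real_derivative_iff_has_vector_derivative)
  have pw: "exp (- (a / 3)) \<le> 3 / (1 + a)" if "a \<ge> 0" for a :: real
  proof -
    have "1 + a / 3 \<le> exp (a / 3)" by (rule exp_ge_add_one_self)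
    then have "(1 + a) / 3 \<le> exp (a / 3)" unfolding add_divide_distrib by linarith
    then have "exp (- (a / 3)) * ((1 + a) / 3) \<le> 1" by (simp add: exp_minus field_simps)
    then show ?thesis using that by (simp add: field_simps)
  qed
  have "J \<le> ?F 1 - ?F 0"
    by (rule has_integral_le[OF J I]) (use pw in auto)
  also have "\<dots> \<le> 3 * \<epsilon> * 2"
    using arctan_ubound[of "1 / \<epsilon>"] pi_less_4 assms by simp
  finally show ?thesis using J by auto
qed

text \<open>Esseen's bound: the concentration of a random variable at scale \<open>\<epsilon>\<close> is controlled by its
  characteristic function on \<open>[0, 1/\<epsilon>]\<close>. Only coordinates where \<open>v\<close> and \<open>u\<close> agree can contribute
  decay, so no conditioning on the remaining ones is needed.\<close>

lemma small_ball:
  assumes \<epsilon>: "\<epsilon> > 0" and n2: "(\<Sum>i<d. (v i)\<^sup>2) = 1" and n4: "(\<Sum>i<d. (v i) ^ 4) \<le> \<epsilon>\<^sup>2"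
    and uv: "\<And>i. i < d \<Longrightarrow> v i \<noteq> 0 \<Longrightarrow> u i = v i"
  shows "measure_pmf.prob (pmf_of_set (cube d)) {x. \<bar>dotp d u x + \<tau>\<bar> \<le> \<epsilon>} \<le> 14 * \<epsilon>"
proof -
  let ?M = "pmf_of_set (cube d)"
  define k where "k = (\<lambda>w::real. if w = 0 then 1/2 else (1 - cos w) / w\<^sup>2)"
  \<comment> \<open>Rescaling turns the event into \<open>|Y x| <= 1\<close>, where the kernel
    \<open>k\<close> is at least 11/24.\<close>
  define Y where "Y = (\<lambda>x. (dotp d u x + \<tau>) / \<epsilon>)"
  have ne: "cube d \<noteq> {}" unfolding cube_def by (auto simp: PiE_dflt_empty_iff)
  have E: "measure_pmf.expectation ?M f = (\<Sum>x\<in>cube d. f x) / card (cube d)" for f :: "_ \<Rightarrow> real"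
    by (simp add: integral_pmf_of_set ne finite_cube)
  have char: "measure_pmf.expectation ?M (\<lambda>x. cos (s * Y x)) \<le> exp (- ((s / \<epsilon>)\<^sup>2 / 3))"
    if "s \<in> {0..1}" for s
  proof -
    have eq: "s * Y x = s * \<tau> / \<epsilon> + dotp d (\<lambda>i. s / \<epsilon> * u i) x" for x
      by (simp add: Y_def dotp_def add_divide_distrib distrib_left sum_distrib_left sum_divide_distrib mult.assoc add.commute)
    have "measure_pmf.expectation ?M (\<lambda>x. cos (s * Y x)) = cos (s * \<tau> / \<epsilon>) * (\<Prod>i<d. cos (s / \<epsilon> * u i))"
      unfolding eq by (rule expectation_cube_cos)
    also have "\<dots> \<le> \<bar>cos (s * \<tau> / \<epsilon>)\<bar> * (\<Prod>i<d. \<bar>cos (s / \<epsilon> * u i)\<bar>)"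
      by (metis abs_ge_self abs_mult abs_prod)
    \<comment> \<open>Off the support of \<open>v\<close> the factor is bounded by 1, which is
      \<open>cos 0\<close>.\<close>
    also have "\<dots> \<le> 1 * (\<Prod>i<d. \<bar>cos (s / \<epsilon> * v i)\<bar>)"
      using uv by (intro mult_mono prod_mono prod_nonneg) (auto, force)
    also have "\<dots> \<le> exp (- ((s / \<epsilon>)\<^sup>2 / 3))"
      using prod_cos_le[OF n2 n4, of "s / \<epsilon>"] that \<epsilon> by simp
    finally show ?thesis .
  qed
  \<comment> \<open>Expectation and frequency integral are exchanged: the expectation is a finite
    average.\<close>
  have I: "((\<lambda>s. (1 - s) * measure_pmf.expectation ?M (\<lambda>x. cos (s * Y x)))
      has_integral (measure_pmf.expectation ?M (\<lambda>x. k (Y x)))) {0..1}"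
  proof -
    have "((\<lambda>s. (\<Sum>x\<in>cube d. (1 - s) * cos (s * Y x)) / card (cube d))
      has_integral ((\<Sum>x\<in>cube d. k (Y x)) / card (cube d))) {0..1}"
      unfolding k_def by (intro has_integral_divide has_integral_sum fejer_has_integral finite_cube)
    then show ?thesis by (simp add: E sum_distrib_left)
  qed
  obtain J where J: "((\<lambda>s. exp (- ((s / \<epsilon>)\<^sup>2 / 3))) has_integral J) {0..1}" "J \<le> 6 * \<epsilon>"
    using gaussian_integral_le[OF \<epsilon>] by blast
  have "11/24 * measure_pmf.prob ?M {x. \<bar>dotp d u x + \<tau>\<bar> \<le> \<epsilon>}
      = measure_pmf.expectation ?M (\<lambda>x. 11/24 * indicator {x. \<bar>dotp d u x + \<tau>\<bar> \<le> \<epsilon>} x)"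
    by simp
  also have "\<dots> \<le> measure_pmf.expectation ?M (\<lambda>x. k (Y x))"
  proof (intro integral_mono)
    fix x
    show "11/24 * indicator {x. \<bar>dotp d u x + \<tau>\<bar> \<le> \<epsilon>} x \<le> k (Y x)"
      using fejer_ge[of "Y x"] fejer_nonneg[of "Y x"] \<epsilon>
      by (auto simp: indicator_def k_def Y_def)
  qed auto
  also have "\<dots> \<le> J"
  proof (rule has_integral_le[OF I J(1)])
    fix s :: real assume s: "s \<in> {0..1}"
    have "(1 - s) * measure_pmf.expectation ?M (\<lambda>x. cos (s * Y x)) \<le> (1 - s) * exp (- ((s / \<epsilon>)\<^sup>2 / 3))"
      using char[OF s] s by (intro mult_left_mono) auto
    also have "\<dots> \<le> 1 * exp (- ((s / \<epsilon>)\<^sup>2 / 3))" using s by (intro mult_right_mono) auto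
    finally show "(1 - s) * measure_pmf.expectation ?M (\<lambda>x. cos (s * Y x)) \<le> exp (- ((s / \<epsilon>)\<^sup>2 / 3))"
      by simp
  qed
  \<comment> \<open>6 * 24/11 is less than 14.\<close>
  finally show ?thesis using J(2) \<epsilon> by simp
qed

section \<open>Reasoning about programs\<close>

text \<open>\<open>N\<close> only bounds the number of steps, so branches of different lengths need no padding.\<close>

definition det ::
  "((nat \<Rightarrow> real) \<times> real) pmf \<Rightarrow> com \<Rightarrow> state \<Rightarrow> nat \<Rightarrow> (state \<Rightarrow> bool) \<Rightarrow> bool" where
  "det D c s N Q \<longleftrightarrow> (\<exists>n\<le>N. \<exists>s'. Q s' \<and>
     (\<forall>t k. steps D (n + t) (c # k, s) = steps D t (k, s')))"

lemma det_conseq: "det D c s N P \<Longrightarrow> N \<le> N' \<Longrightarrow> (\<And>s'. P s' \<Longrightarrow> Q s') \<Longrightarrow> det D c s N' Q"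
  unfolding det_def by (blast intro: order_trans)

lemma det_ISet: "Q (set_ireg r (ival e s) s) \<Longrightarrow> det D (ISet r e) s 1 Q"
  unfolding det_def by (intro exI[of _ 1] conjI exI) (auto simp: bind_return_pmf)

lemma det_RSet: "Q (set_cell a (ival i s) (rval e s) s) \<Longrightarrow> det D (RSet a i e) s 1 Q"
  unfolding det_def by (intro exI[of _ 1] conjI exI) (auto simp: bind_return_pmf)

lemma det_Seq:
  assumes "det D c1 s N1 P" "\<And>s1. P s1 \<Longrightarrow> det D c2 s1 N2 Q"
  shows "det D (Seq c1 c2) s (Suc (N1 + N2)) Q"
proof -
  obtain n1 s1 where 1: "n1 \<le> N1" "P s1" "\<And>t k. steps D (n1 + t) (c1 # k, s) = steps D t (k, s1)"
    using assms(1) unfolding det_def by blast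
  obtain n2 s2 where 2: "n2 \<le> N2" "Q s2" "\<And>t k. steps D (n2 + t) (c2 # k, s1) = steps D t (k, s2)"
    using assms(2)[OF 1(2)] unfolding det_def by blast
  have "steps D (Suc (n1 + n2) + t) (Seq c1 c2 # k, s) = steps D t (k, s2)" for t k
    using 1(3)[of "n2 + t"] 2(3) by (simp add: bind_return_pmf add.assoc)
  then show ?thesis
    unfolding det_def using 1(1) 2(1,2) by (intro exI[of _ "Suc (n1 + n2)"]) auto
qed

lemma det_Cond:
  assumes "bval b s \<Longrightarrow> det D c1 s N Q" "\<not> bval b s \<Longrightarrow> det D c2 s N Q"
  shows "det D (Cond b c1 c2) s (Suc N) Q"
proof -
  obtain n s' where 1: "n \<le> N" "Q s'"
    "\<And>t k. steps D (n + t) ((if bval b s then c1 else c2) # k, s) = steps D t (k, s')"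
    using assms unfolding det_def by (cases "bval b s") auto
  then show ?thesis
    unfolding det_def by (intro exI[of _ "Suc n"] conjI exI[of _ s']) (auto simp: bind_return_pmf)
qed

text \<open>The number \<open>n\<close> of iterations is fixed in advance, and \<open>I j\<close>
  holds after \<open>j\<close> of them. The outer \<open>Suc\<close> pays for the final guard
  test.\<close>

lemma det_While:
  assumes "I 0 s"
    and body: "\<And>j s. j < n \<Longrightarrow> I j s \<Longrightarrow> bval b s \<and> det D c s N (I (Suc j))"
    and exit: "\<And>s. I n s \<Longrightarrow> \<not> bval b s"
  shows "det D (While b c) s (Suc (n * Suc N)) (I n)"
proof -
  have "I j s \<Longrightarrow> j \<le> n \<Longrightarrow> det D (While b c) s (Suc ((n - j) * Suc N)) (I n)" for j s
  proof (induction "n - j" arbitrary: j s)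
    case 0
    then have j: "j = n" by simp
    with 0 exit have "\<not> bval b s" by simp
    with 0 j show ?case
      unfolding det_def by (intro exI[of _ 1] conjI exI[of _ s]) (auto simp: bind_return_pmf)
  next
    case (Suc m)
    then have j: "j < n" and m: "m = n - Suc j" by auto
    have b: "bval b s" and d: "det D c s N (I (Suc j))" using body[OF j Suc.prems(1)] by auto
    obtain n1 s1 where 1: "n1 \<le> N" "I (Suc j) s1" "\<And>t k. steps D (n1 + t) (c # k, s) = steps D t (k, s1)"
      using d unfolding det_def by blast
    obtain n2 s2 where 2: "n2 \<le> Suc (m * Suc N)" "I n s2"
      "\<And>t k. steps D (n2 + t) (While b c # k, s1) = steps D t (k, s2)"
      using Suc.hyps(1)[OF m 1(2)] j m unfolding det_def by auto
    have "steps D (Suc (n1 + n2) + t) (While b c # k, s) = steps D t (k, s2)" for t k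
      using b 1(3)[of "n2 + t"] 2(3) by (simp add: bind_return_pmf add.assoc)
    moreover have "Suc (n1 + n2) \<le> Suc ((n - j) * Suc N)"
      using 1(1) 2(1) by (simp flip: Suc.hyps(2))
    ultimately show ?case unfolding det_def using 2(2) by blast
  qed
  from this[of 0 s] assms(1) show ?thesis by simp
qed

section \<open>Halting and failure probability\<close>

text \<open>A judgement about the commands still to run, derived backwards from the empty stack:
  halting is certain, only \<open>Bad\<close> is bounded in probability, and \<open>p\<close> may
  depend on the current memory.\<close>

definition halts_with ::
  "((nat \<Rightarrow> real) \<times> real) pmf \<Rightarrow> nat \<Rightarrow> config \<Rightarrow> (state \<Rightarrow> bool) \<Rightarrow> real \<Rightarrow> bool" where
  "halts_with D t cfg Bad p \<longleftrightarrow> (\<forall>cfg'\<in>set_pmf (steps D t cfg). halted cfg') \<and>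
     measure_pmf.prob (steps D t cfg) {cfg'. Bad (snd cfg')} \<le> p"

lemma halts_with_mono: "halts_with D t cfg Bad p \<Longrightarrow> p \<le> q \<Longrightarrow> halts_with D t cfg Bad q"
  unfolding halts_with_def by auto

lemma steps_halted: "steps D t ([], s) = return_pmf ([], s)"
  by (induction t) (auto simp: bind_return_pmf)

lemma halts_with_return: "(if Bad s then 1 else 0) \<le> p \<Longrightarrow> halts_with D t ([], s) Bad p"
  by (auto simp: halts_with_def steps_halted halted_def split: if_splits)

lemma steps_add: "steps D (m + t) cfg = bind_pmf (steps D m cfg) (steps D t)"
proof (induction m arbitrary: cfg)
  case (Suc m)
  then have "steps D (m + t) = (\<lambda>c. bind_pmf (steps D m c) (steps D t))" by blast
  then show ?case by (simp add: bind_assoc_pmf del: split_paired_All)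
qed (simp add: bind_return_pmf)

text \<open>Halted configurations are absorbing, so a time budget may be enlarged freely.\<close>

lemma steps_after_halt:
  assumes "\<forall>cfg'\<in>set_pmf (steps D t cfg). halted cfg'" "t \<le> t'"
  shows "steps D t' cfg = steps D t cfg"
proof -
  have "steps D t' cfg = bind_pmf (steps D t cfg) (steps D (t' - t))"
    using steps_add[where m = t and t = "t' - t" and D = D and cfg = cfg] assms(2) by simp
  also have "\<dots> = bind_pmf (steps D t cfg) return_pmf"
  proof (intro bind_pmf_cong refl)
    fix c assume "c \<in> set_pmf (steps D t cfg)"
    then have "fst c = []" using assms(1) by (auto simp: halted_def)
    then show "steps D (t' - t) c = return_pmf c" by (cases c) (simp add: steps_halted)
  qed
  finally show ?thesis by (simp add: bind_return_pmf')
qed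

lemma halts_with_le: "halts_with D t cfg Bad p \<Longrightarrow> t \<le> t' \<Longrightarrow> halts_with D t' cfg Bad p"
  using steps_after_halt[where D = D and t = t and cfg = cfg and t' = t'] unfolding halts_with_def by simp

lemma halts_with_det:
  assumes "det D c s N Q" "\<And>s'. Q s' \<Longrightarrow> halts_with D t (k, s') Bad p"
  shows "halts_with D (N + t) (c # k, s) Bad p"
proof -
  obtain n s' where n: "n \<le> N" "Q s'" "\<And>t k. steps D (n + t) (c # k, s) = steps D t (k, s')"
    using assms(1) unfolding det_def by blast
  have "halts_with D (n + t) (c # k, s) Bad p"
    using assms(2)[OF n(2)] n(3) by (simp add: halts_with_def)
  then show ?thesis by (rule halts_with_le) (use n in simp)
qed

lemma halts_with_Seq: "halts_with D t (c1 # c2 # k, s) Bad p \<Longrightarrow> halts_with D (Suc t) (Seq c1 c2 # k, s) Bad p"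
  by (simp add: halts_with_def bind_return_pmf)

lemma halts_with_While:
  "halts_with D t (if bval b s then c # While b c # k else k, s) Bad p
    \<Longrightarrow> halts_with D (Suc t) (While b c # k, s) Bad p"
  by (simp add: halts_with_def bind_return_pmf)

lemma prob_bind_pmf:
  "measure_pmf.prob (bind_pmf M f) A = measure_pmf.expectation M (\<lambda>x. measure_pmf.prob (f x) A)"
proof -
  have "measure_pmf.prob (bind_pmf M f) A = enn2real (\<integral>\<^sup>+x. emeasure (f x) A \<partial>M)"
    by (simp add: measure_def)
  also have "\<dots> = measure_pmf.expectation M (\<lambda>x. measure_pmf.prob (f x) A)"
    by (subst integral_eq_nn_integral) (auto simp: measure_pmf.emeasure_eq_measure)
  finally show ?thesis .
qed

text \<open>Law of total probability: the failure bound before a draw is the average of the bounds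
  after it.\<close>

lemma halts_with_Sample:
  assumes fin: "finite (set_pmf D)"
    and p: "\<And>z. z \<in> set_pmf D \<Longrightarrow>
      halts_with D t (k, set_cell b 0 (snd z) (set_arr a (fst z) s)) Bad (p z)"
  shows "halts_with D (Suc t) (Sample a b # k, s) Bad (measure_pmf.expectation D p)"
proof -
  let ?s = "\<lambda>z. (k, set_cell b 0 (snd z) (set_arr a (fst z) s))"
  have eq: "steps D (Suc t) (Sample a b # k, s) = bind_pmf D (\<lambda>z. steps D t (?s z))"
    by (simp add: bind_map_pmf case_prod_beta')
  have "measure_pmf.prob (steps D (Suc t) (Sample a b # k, s)) {cfg'. Bad (snd cfg')}
      \<le> measure_pmf.expectation D p"
    unfolding eq prob_bind_pmf
    using p by (intro integral_mono_AE AE_pmfI integrable_measure_pmf_finite fin) (auto simp: halts_with_def)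
  then show ?thesis using p unfolding halts_with_def eq by auto
qed

section \<open>The learner\<close>

lemma det_le: "det D c s N Q \<Longrightarrow> N \<le> N' \<Longrightarrow> det D c s N' Q"
  by (rule det_conseq)

lemma det_RSet_Seq:
  "det D c (set_cell a (ival i s) (rval e s) s) N Q \<Longrightarrow> det D (Seq (RSet a i e) c) s (Suc (1 + N)) Q"
  by (rule det_Seq[OF det_RSet[where Q = "\<lambda>s'. s' = set_cell a (ival i s) (rval e s) s"]]) auto

lemma det_ISet_Seq:
  "det D c (set_ireg r (ival e s) s) N Q \<Longrightarrow> det D (Seq (ISet r e) c) s (Suc (1 + N)) Q"
  by (rule det_Seq[OF det_ISet[where Q = "\<lambda>s'. s' = set_ireg r (ival e s) s"]]) auto

lemma ireg_set [simp]:
  "ireg (set_ireg r n s) r' = (if r' = r then n else ireg s r')"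
  "ireg (set_arr a x s) = ireg s" "ireg (set_cell a i y s) = ireg s"
  by (auto simp: set_ireg_def set_arr_def set_cell_def)

lemma arr_set [simp]:
  "arr (set_ireg r n s) = arr s"
  "arr (set_arr a x s) a' = (if a' = a then x else arr s a')"
  "arr (set_cell a i y s) a' = (if a' = a then (arr s a)(i := y) else arr s a')"
  by (auto simp: set_ireg_def set_arr_def set_cell_def)

text \<open>Integer registers: 0 holds \<open>d\<close>, 1 is a coordinate index, 2 counts the examples, 3 holds the
  bandwidth. Arrays: 3 accumulates the iterates, 4 is the current iterate, 5 and 6 hold the current
  example, 7 is scratch space.\<close>

definition for_coords :: "com \<Rightarrow> com" where
  "for_coords c = Seq (ISet 1 (IConst 0))
     (While (BNot (ILe (IReg 0) (IReg 1))) (Seq c (ISet 1 (IAdd (IReg 1) (IConst 1)))))"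

abbreviation "cell a i \<equiv> RCell a (IConst i)"
abbreviation "entry a \<equiv> RCell a (IReg 1)"

text \<open>Doubling \<epsilon> until it reaches 1 counts out an integer logarithm, which serves as
  the bandwidth.\<close>

definition halvings :: com where
  "halvings = Seq (RSet 7 (IConst 0) (cell 0 0))
     (While (BNot (RLe (RConst 1) (cell 7 0)))
       (Seq (RSet 7 (IConst 0) (RAdd (cell 7 0) (cell 7 0))) (ISet 3 (IAdd (IReg 3) (IConst 1)))))"

text \<open>The iterate joins the running sum before the current example changes it, so each summand
  is independent of the example it is tested on.\<close>

definition scores :: com where
  "scores = Seq (RSet 7 (IConst 0) (cell 0 1)) (Seq (RSet 7 (IConst 1) (RConst 0))
     (for_coords
       (Seq (RSet 7 (IConst 0) (RAdd (cell 7 0) (RMul (entry 2) (entry 5))))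
       (Seq (RSet 7 (IConst 1) (RAdd (cell 7 1) (RMul (entry 4) (entry 5))))
            (RSet 3 (IReg 1) (RAdd (entry 3) (entry 4)))))))"

definition coefficient :: com where
  "coefficient = Cond
     (BAnd (BAnd (RLe (RSub (RConst 0) (ROfInt (IReg 3))) (cell 7 0)) (RLe (cell 7 0) (ROfInt (IReg 3))))
       (RLe (RMul (cell 6 0) (RAdd (cell 7 0) (cell 7 1))) (cell 0 0)))
     (RSet 7 (IConst 2) (RMul (RDiv (RMul (cell 0 0) (cell 0 0)) (ROfInt (IReg 0))) (cell 6 0)))
     (RSet 7 (IConst 2) (RConst 0))"

text \<open>The squared length of the new iterate is accumulated in the same pass, for the reset
  test.\<close>

definition descend :: com where
  "descend = Seq (RSet 7 (IConst 3) (RConst 0))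
     (for_coords
       (Seq (RSet 4 (IReg 1) (RAdd (entry 4) (RMul (cell 7 2) (entry 5))))
            (RSet 7 (IConst 3) (RAdd (cell 7 3) (RMul (entry 4) (entry 4))))))"

definition reset :: com where
  "reset = Seq (Cond (RLe (cell 7 3) (RConst 4)) (RSet 7 (IConst 4) (RConst 1)) (RSet 7 (IConst 4) (RConst 0)))
     (for_coords (RSet 4 (IReg 1) (RMul (cell 7 4) (entry 4))))"

definition update :: com where
  "update = Seq scores (Seq coefficient (Seq descend (Seq reset (ISet 2 (IAdd (IReg 2) (IConst 1))))))"

text \<open>The comparison of the number of examples with \<open>d / \<epsilon>^4\<close>,
  multiplied out; no ceiling has to be computed.\<close>

definition enough_examples :: bexp where
  "enough_examples = RLe (ROfInt (IReg 0))
     (RMul (ROfInt (IReg 2)) (RMul (RMul (cell 0 0) (cell 0 0)) (RMul (cell 0 0) (cell 0 0))))"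

definition average :: com where
  "average = for_coords (RSet 3 (IReg 1) (RAdd (entry 2) (RDiv (entry 3) (ROfInt (IReg 2)))))"

definition learner :: com where
  "learner = Seq halvings (Seq (While (BNot enough_examples) (Seq (Sample 5 6) update)) average)"

section \<open>Effect and cost of the subroutines\<close>

text \<open>\<open>I\<close> must be insensitive to register 1, since the counter moves after the
  body has established \<open>I (Suc j)\<close>. Guard, sequencing and increment add 3 steps per
  coordinate.\<close>

lemma det_for_coords:
  assumes d: "ireg s 0 = d" and init: "I 0 s"
    and inv: "\<And>j n s. I j s \<Longrightarrow> I j (set_ireg 1 n s)"
    and body: "\<And>j s. j < d \<Longrightarrow> ireg s 0 = d \<Longrightarrow> ireg s 1 = j \<Longrightarrow> I j s \<Longrightarrow>
      det D c s N (\<lambda>s'. ireg s' 0 = d \<and> ireg s' 1 = j \<and> I (Suc j) s')"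
  shows "det D (for_coords c) s (d * (N + 3) + 3) (I d)"
proof -
  let ?I = "\<lambda>j s. ireg s 0 = d \<and> ireg s 1 = j \<and> I j s"
  have "det D (While (BNot (ILe (IReg 0) (IReg 1))) (Seq c (ISet 1 (IAdd (IReg 1) (IConst 1)))))
      (set_ireg 1 0 s) (Suc (d * Suc (Suc (N + 1)))) (?I d)"
  proof (rule det_While[where I = ?I])
    fix j s assume j: "j < d" and I: "?I j s"
    have "det D (Seq c (ISet 1 (IAdd (IReg 1) (IConst 1)))) s (Suc (N + 1)) (?I (Suc j))"
    proof (rule det_Seq)
      show "det D c s N (\<lambda>s'. ireg s' 0 = d \<and> ireg s' 1 = j \<and> I (Suc j) s')"
        using j I by (intro body) auto
      show "det D (ISet 1 (IAdd (IReg 1) (IConst 1))) s1 1 (?I (Suc j))"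
        if "ireg s1 0 = d \<and> ireg s1 1 = j \<and> I (Suc j) s1" for s1
        using that by (intro det_ISet) (auto intro: inv[unfolded One_nat_def])
    qed
    then show "bval (BNot (ILe (IReg 0) (IReg 1))) s \<and>
        det D (Seq c (ISet 1 (IAdd (IReg 1) (IConst 1)))) s (Suc (N + 1)) (?I (Suc j))"
      using j I by simp
  qed (use d init inv in auto)
  then have "det D (for_coords c) s (Suc (1 + Suc (d * Suc (Suc (N + 1))))) (?I d)"
    unfolding for_coords_def by (intro det_ISet_Seq) simp
  then show ?thesis by (rule det_conseq) (auto simp: algebra_simps)
qed

lemma dotp_Suc: "dotp (Suc d) v x = dotp d v x + v d * x d"
  by (simp add: dotp_def)

text \<open>The Archimedean property makes \<open>K\<close> well defined, and its minimality keeps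
  the guard true for exactly \<open>K\<close> iterations.\<close>

lemma det_halvings:
  assumes "ireg s 3 = 0" "0 < arr s 0 0" and K: "K = (LEAST k. 1 \<le> 2 ^ k * arr s 0 0)"
  shows "det D halvings s (K * 5 + 3) (\<lambda>s'.
    (\<forall>r. r \<noteq> 3 \<longrightarrow> ireg s' r = ireg s r) \<and> ireg s' 3 = K \<and> (\<forall>a. a \<noteq> 7 \<longrightarrow> arr s' a = arr s a))"
proof -
  let ?e = "arr s 0 0"
  let ?I = "\<lambda>j (s'::state). (\<forall>r. r \<noteq> 3 \<longrightarrow> ireg s' r = ireg s r) \<and> ireg s' 3 = j \<and>
      (\<forall>a. a \<noteq> 7 \<longrightarrow> arr s' a = arr s a) \<and> arr s' 7 0 = 2 ^ j * ?e"
  obtain k where "1 / ?e < 2 ^ k" using real_arch_pow[of 2 "1 / ?e"] by auto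
  then have ex: "1 \<le> 2 ^ k * ?e" using assms(2) by (simp add: field_simps)
  have exit: "1 \<le> 2 ^ K * ?e" unfolding K by (rule LeastI) (rule ex)
  have less: "\<not> 1 \<le> 2 ^ j * ?e" if "j < K" for j using that unfolding K by (rule not_less_Least)
  have "det D (While (BNot (RLe (RConst 1) (cell 7 0)))
       (Seq (RSet 7 (IConst 0) (RAdd (cell 7 0) (cell 7 0))) (ISet 3 (IAdd (IReg 3) (IConst 1)))))
      (set_cell 7 0 ?e s) (Suc (K * Suc 3)) (?I K)"
  proof (rule det_While[where I = ?I])
    fix j s' assume j: "j < K" and I: "?I j s'"
    have "det D (Seq (RSet 7 (IConst 0) (RAdd (cell 7 0) (cell 7 0))) (ISet 3 (IAdd (IReg 3) (IConst 1)))) s' 3 (?I (Suc j))"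
      by (rule det_le, rule det_RSet_Seq, rule det_ISet) (use I in auto)
    then show "bval (BNot (RLe (RConst 1) (cell 7 0))) s' \<and>
        det D (Seq (RSet 7 (IConst 0) (RAdd (cell 7 0) (cell 7 0))) (ISet 3 (IAdd (IReg 3) (IConst 1)))) s' 3 (?I (Suc j))"
      using I less[OF j] by auto
  qed (use assms(1) exit in auto)
  then have "det D halvings s (Suc (1 + Suc (K * Suc 3))) (?I K)"
    unfolding halvings_def by (intro det_RSet_Seq) simp
  then show ?thesis by (rule det_conseq) auto
qed

lemma det_scores:
  assumes "ireg s 0 = d"
  shows "det D scores s (d * 8 + 7) (\<lambda>s'.
    (\<forall>r. r \<noteq> 1 \<longrightarrow> ireg s' r = ireg s r) \<and> (\<forall>a. a \<notin> {3, 7} \<longrightarrow> arr s' a = arr s a) \<and>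
    arr s' 7 0 = dotp d (arr s 2) (arr s 5) + arr s 0 1 \<and> arr s' 7 1 = dotp d (arr s 4) (arr s 5) \<and>
    (\<forall>i<d. arr s' 3 i = arr s 3 i + arr s 4 i))"
proof -
  let ?I = "\<lambda>j (s'::state). (\<forall>r. r \<noteq> 1 \<longrightarrow> ireg s' r = ireg s r) \<and> (\<forall>a. a \<notin> {3, 7} \<longrightarrow> arr s' a = arr s a) \<and>
    arr s' 7 0 = dotp j (arr s 2) (arr s 5) + arr s 0 1 \<and> arr s' 7 1 = dotp j (arr s 4) (arr s 5) \<and>
    (\<forall>i. arr s' 3 i = arr s 3 i + (if i < j then arr s 4 i else 0))"
  have "det D scores s (Suc (1 + Suc (1 + (d * (5 + 3) + 3)))) (?I d)"
    unfolding scores_def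
  proof (intro det_RSet_Seq det_for_coords, goal_cases)
    case (4 j s')
    show ?case
      by (rule det_le, rule det_RSet_Seq, rule det_RSet_Seq, rule det_RSet) (use 4 in \<open>auto simp: dotp_Suc\<close>)
  qed (use assms in \<open>auto simp: dotp_def\<close>)
  then show ?thesis by (rule det_conseq) auto
qed

lemma det_coefficient:
  "det D coefficient s 2 (\<lambda>s'. (\<forall>r. ireg s' r = ireg s r) \<and> (\<forall>a. a \<noteq> 7 \<longrightarrow> arr s' a = arr s a) \<and>
    arr s' 7 2 = (if \<bar>arr s 7 0\<bar> \<le> real (ireg s 3) \<and> arr s 6 0 * (arr s 7 0 + arr s 7 1) \<le> arr s 0 0
      then (arr s 0 0)\<^sup>2 / real (ireg s 0) * arr s 6 0 else 0))"
  unfolding coefficient_def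
  by (rule det_le, rule det_Cond; (rule det_RSet)?) (auto simp: power2_eq_square abs_le_iff)

lemma det_descend:
  assumes "ireg s 0 = d"
  shows "det D descend s (d * 6 + 5) (\<lambda>s'.
    (\<forall>r. r \<noteq> 1 \<longrightarrow> ireg s' r = ireg s r) \<and> (\<forall>a. a \<notin> {4, 7} \<longrightarrow> arr s' a = arr s a) \<and>
    (\<forall>i<d. arr s' 4 i = arr s 4 i + arr s 7 2 * arr s 5 i) \<and>
    arr s' 7 3 = (\<Sum>i<d. (arr s 4 i + arr s 7 2 * arr s 5 i)\<^sup>2))"
proof -
  let ?I = "\<lambda>j (s'::state). (\<forall>r. r \<noteq> 1 \<longrightarrow> ireg s' r = ireg s r) \<and> (\<forall>a. a \<notin> {4, 7} \<longrightarrow> arr s' a = arr s a) \<and>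
    arr s' 7 2 = arr s 7 2 \<and>
    (\<forall>i. arr s' 4 i = arr s 4 i + (if i < j then arr s 7 2 * arr s 5 i else 0)) \<and>
    arr s' 7 3 = (\<Sum>i<j. (arr s 4 i + arr s 7 2 * arr s 5 i)\<^sup>2)"
  have "det D descend s (Suc (1 + (d * (3 + 3) + 3))) (?I d)"
    unfolding descend_def
  proof (intro det_RSet_Seq det_for_coords, goal_cases)
    case (4 j s')
    show ?case
      by (rule det_le, rule det_RSet_Seq, rule det_RSet) (use 4 in \<open>auto simp: power2_eq_square\<close>)
  qed (use assms in auto)
  then show ?thesis by (rule det_conseq) auto
qed

lemma det_reset:
  assumes "ireg s 0 = d"
  shows "det D reset s (d * 4 + 6) (\<lambda>s'.
    (\<forall>r. r \<noteq> 1 \<longrightarrow> ireg s' r = ireg s r) \<and> (\<forall>a. a \<notin> {4, 7} \<longrightarrow> arr s' a = arr s a) \<and>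
    (\<forall>i<d. arr s' 4 i = (if arr s 7 3 \<le> 4 then arr s 4 i else 0)))"
proof -
  let ?b = "if arr s 7 3 \<le> 4 then 1 else 0"
  let ?P = "\<lambda>s'::state. (\<forall>r. ireg s' r = ireg s r) \<and> (\<forall>a. a \<noteq> 7 \<longrightarrow> arr s' a = arr s a) \<and> arr s' 7 4 = ?b"
  let ?I = "\<lambda>j (s'::state). (\<forall>r. r \<noteq> 1 \<longrightarrow> ireg s' r = ireg s r) \<and> (\<forall>a. a \<notin> {4, 7} \<longrightarrow> arr s' a = arr s a) \<and>
    arr s' 7 4 = ?b \<and> (\<forall>i. arr s' 4 i = (if i < j then ?b else 1) * arr s 4 i)"
  have "det D reset s (Suc (2 + (d * (1 + 3) + 3))) (?I d)"
    unfolding reset_def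
  proof (rule det_Seq[where P = ?P], goal_cases)
    case 1
    show ?case by (rule det_le, rule det_Cond; (rule det_RSet)?) auto
  next
    case (2 s1)
    show ?case
    proof (intro det_for_coords, goal_cases)
      case (4 j s')
      show ?case by (rule det_RSet) (use 4 in auto)
    qed (use 2 assms in auto)
  qed
  then show ?thesis by (rule det_conseq) auto
qed

lemma det_average:
  assumes "ireg s 0 = d"
  shows "det D average s (d * 4 + 3) (\<lambda>s'. \<forall>i<d. arr s' 3 i = arr s 2 i + arr s 3 i / real (ireg s 2))"
proof -
  let ?I = "\<lambda>j (s'::state). (\<forall>r. r \<noteq> 1 \<longrightarrow> ireg s' r = ireg s r) \<and> (\<forall>a. a \<noteq> 3 \<longrightarrow> arr s' a = arr s a) \<and>
    (\<forall>i. arr s' 3 i = (if i < j then arr s 2 i + arr s 3 i / real (ireg s 2) else arr s 3 i))"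
  have "det D average s (d * (1 + 3) + 3) (?I d)"
    unfolding average_def
  proof (intro det_for_coords, goal_cases)
    case (4 j s')
    show ?case by (rule det_RSet) (use 4 in auto)
  qed (use assms in auto)
  then show ?thesis by (rule det_conseq) auto
qed

text \<open>Where the hinge loss with margin \<epsilon> is active, its subgradient is
  \<open>- y * x / \<epsilon>\<close>; the factor here is the step size
  \<open>\<epsilon>^3 / d\<close> divided by \<epsilon>.\<close>

definition gradient_coeff where
  "gradient_coeff \<epsilon> d vhead \<tau> B w x y =
     (if \<bar>dotp d vhead x + \<tau>\<bar> \<le> B \<and> y * (dotp d vhead x + \<tau> + dotp d w x) \<le> \<epsilon> then \<epsilon>\<^sup>2 / real d * y else 0)"

text \<open>Resetting a long iterate to \<open>0\<close> replaces the projection onto the unit ball, which would need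
  square roots: it brings the iterate closer to every vector of the unit ball.\<close>

definition next_iterate where
  "next_iterate \<epsilon> d vhead \<tau> B w x y =
     (let w' = (\<lambda>i. w i + gradient_coeff \<epsilon> d vhead \<tau> B w x y * x i)
      in if (\<Sum>i<d. (w' i)\<^sup>2) \<le> 4 then w' else (\<lambda>_. 0))"

lemma det_update:
  assumes "ireg s 0 = d"
  shows "det D update s (d * 18 + 25) (\<lambda>s'.
    (\<forall>r. r \<notin> {1, 2} \<longrightarrow> ireg s' r = ireg s r) \<and> ireg s' 2 = Suc (ireg s 2) \<and>
    (\<forall>a. a \<notin> {3, 4, 7} \<longrightarrow> arr s' a = arr s a) \<and>
    (\<forall>i<d. arr s' 3 i = arr s 3 i + arr s 4 i) \<and>
    (\<forall>i<d. arr s' 4 i = next_iterate (arr s 0 0) d (arr s 2) (arr s 0 1) (real (ireg s 3))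
       (arr s 4) (arr s 5) (arr s 6 0) i))"
  unfolding update_def
  apply (rule det_le)
   apply (rule det_Seq[OF det_scores[OF assms]])
   apply (rule det_Seq[OF det_coefficient])
   apply (rule det_Seq[OF det_descend])
    apply (use assms in simp)
   apply (rule det_Seq[OF det_reset])
    apply (use assms in simp)
   apply (rule det_ISet)
  subgoal for s1 s2 s3 s4
    using assms by (auto simp: next_iterate_def gradient_coeff_def)
  apply simp
  done

section \<open>Stochastic gradient descent\<close>

lemma dotp_cong: "(\<And>i. i < d \<Longrightarrow> v i = w i) \<Longrightarrow> dotp d v x = dotp d w x"
  by (simp add: dotp_def)

lemma dotp_add: "dotp d (\<lambda>i. v i + w i) x = dotp d v x + dotp d w x"
  by (simp add: dotp_def sum.distrib distrib_right)

lemma dotp_scale: "dotp d (\<lambda>i. c * v i) x = c * dotp d v x"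
  by (simp add: dotp_def sum_distrib_left mult.assoc)

lemma sum_cube_squares: "x \<in> cube d \<Longrightarrow> (\<Sum>i<d. (x i)\<^sup>2) = real d"
proof -
  assume "x \<in> cube d"
  then have "(x i)\<^sup>2 = 1" if "i < d" for i
    using that by (auto simp: cube_def PiE_dflt_def)
  then show ?thesis by simp
qed

text \<open>\<open>v\<close> is the comparator of the regret analysis and ranges over the unit
  ball.\<close>

locale noisy_halfspace =
  fixes \<epsilon> :: real and d :: nat and vhead :: "nat \<Rightarrow> real" and \<tau> :: real
    and D :: "((nat \<Rightarrow> real) \<times> real) pmf" and v :: "nat \<Rightarrow> real"
  assumes \<epsilon>: "0 < \<epsilon>" "\<epsilon> < 1" and d: "0 < d"
    and supp: "set_pmf D \<subseteq> cube d \<times> {-1, 1}"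
    and v: "(\<Sum>i<d. (v i)\<^sup>2) \<le> 1"
begin

text \<open>An integer proxy for the binary logarithm of \<open>1 / \<epsilon>\<close>.\<close>

definition bandwidth :: nat where "bandwidth = (LEAST k. 1 \<le> 2 ^ k * \<epsilon>)"

text \<open>Enough rounds that \<open>rounds\<close> squared step lengths
  \<open>\<epsilon>^4 / d\<close> cover the initial squared distance to the comparator, at most
  1.\<close>

definition rounds :: nat where "rounds = nat \<lceil>real d / \<epsilon> ^ 4\<rceil>"

definition offset :: "(nat \<Rightarrow> real) \<Rightarrow> real" where "offset x = dotp d vhead x + \<tau>"

text \<open>The hinge loss with margin \<open>\<epsilon>\<close>, restricted to the band where the head does not already
  decide the sign. It is homogenised: \<open>hinge m S\<close> is \<open>m\<close> times the loss of \<open>S / m\<close>, so that convexity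
  becomes subadditivity.\<close>

definition hinge :: "real \<Rightarrow> (nat \<Rightarrow> real) \<Rightarrow> (nat \<Rightarrow> real) \<times> real \<Rightarrow> real" where
  "hinge m S z = (if \<bar>offset (fst z)\<bar> \<le> bandwidth
     then max 0 (m - snd z * (m * offset (fst z) + dotp d S (fst z)) / \<epsilon>) else 0)"

abbreviation E :: "((nat \<Rightarrow> real) \<times> real \<Rightarrow> real) \<Rightarrow> real" where
  "E \<equiv> measure_pmf.expectation D"

abbreviation advance :: "(nat \<Rightarrow> real) \<Rightarrow> (nat \<Rightarrow> real) \<times> real \<Rightarrow> nat \<Rightarrow> real" where
  "advance w z \<equiv> next_iterate \<epsilon> d vhead \<tau> (real bandwidth) w (fst z) (snd z)"

definition dist2 :: "(nat \<Rightarrow> real) \<Rightarrow> real" where "dist2 w = (\<Sum>i<d. (w i - v i)\<^sup>2)"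

lemma finite_supp: "finite (set_pmf D)"
  by (rule finite_subset[OF supp]) (simp add: finite_cube)

lemma integrable_D [simp]: "integrable (measure_pmf D) (f :: _ \<Rightarrow> real)"
  by (rule integrable_measure_pmf_finite[OF finite_supp])

lemma expectation_mono: "(\<And>z. z \<in> set_pmf D \<Longrightarrow> f z \<le> g z) \<Longrightarrow> E f \<le> E g"
  by (intro integral_mono_AE AE_pmfI) auto

lemma expectation_add_const: "E (\<lambda>z. c + f z) = c + E f"
  by (subst Bochner_Integration.integral_add) auto

lemma expectation_add: "E (\<lambda>z. f z + g z) = E f + E g"
  by (rule Bochner_Integration.integral_add) auto

lemma expectation_diff: "E (\<lambda>z. f z - g z) = E f - E g"
  by (rule Bochner_Integration.integral_diff) auto

lemma hinge_nonneg: "0 \<le> hinge m S z"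
  by (simp add: hinge_def)

lemma hinge_cong: "(\<And>i. i < d \<Longrightarrow> S i = S' i) \<Longrightarrow> hinge m S z = hinge m S' z"
  using dotp_cong[of d S S'] by (simp add: hinge_def)

lemma hinge_add: "hinge (m + m') (\<lambda>i. S i + w i) z \<le> hinge m S z + hinge m' w z"
proof -
  have "m + m' - snd z * ((m + m') * offset (fst z) + (dotp d S (fst z) + dotp d w (fst z))) / \<epsilon>
    = (m - snd z * (m * offset (fst z) + dotp d S (fst z)) / \<epsilon>)
      + (m' - snd z * (m' * offset (fst z) + dotp d w (fst z)) / \<epsilon>)"
    using \<epsilon> by (simp add: field_simps)
  then show ?thesis by (auto simp: hinge_def dotp_add max_def)
qed

lemma hinge_scale: "c \<ge> 0 \<Longrightarrow> hinge (c * m) (\<lambda>i. c * S i) z = c * hinge m S z"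
proof -
  assume c: "c \<ge> 0"
  have "c * m - snd z * (c * m * offset (fst z) + c * dotp d S (fst z)) / \<epsilon>
     = c * (m - snd z * (m * offset (fst z) + dotp d S (fst z)) / \<epsilon>)"
    by (simp add: algebra_simps)
  then show ?thesis
    using c by (simp add: hinge_def dotp_scale max_mult_distrib_left mult_nonneg_nonpos)
qed

lemma next_iterate_norm: "(\<Sum>i<d. (next_iterate \<epsilon> d vhead \<tau> B w x y i)\<^sup>2) \<le> 4"
  by (simp add: next_iterate_def Let_def)

text \<open>The one-step inequality of subgradient descent: expand the squared distance, bound the
  cross term by convexity of the hinge loss, and use that \<open>x\<close> has squared length
  \<open>d\<close>.\<close>

lemma dist2_next_iterate:
  assumes z: "z \<in> set_pmf D"
  shows "dist2 (advance w z)
    \<le> dist2 w - 2 * (\<epsilon> ^ 3 / d) * hinge 1 w z + 2 * (\<epsilon> ^ 3 / d) * hinge 1 v z + \<epsilon> ^ 4 / d"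
proof -
  obtain x y where xy: "z = (x, y)" by (cases z)
  have x: "(\<Sum>i<d. (x i)\<^sup>2) = real d" and y: "y = -1 \<or> y = 1"
    using z supp sum_cube_squares[of x d] by (auto simp: xy)
  define g where "g = gradient_coeff \<epsilon> d vhead \<tau> (real bandwidth) w x y"
  define w' where "w' = (\<lambda>i. w i + g * x i)"
  have eq: "dist2 w' = dist2 w + 2 * g * (dotp d w x - dotp d v x) + g\<^sup>2 * d"
  proof -
    have "dist2 w' = (\<Sum>i<d. (w i - v i)\<^sup>2 + 2 * g * (w i * x i - v i * x i) + g\<^sup>2 * (x i)\<^sup>2)"
      unfolding dist2_def w'_def by (intro sum.cong) (auto simp: power2_eq_square algebra_simps)
    also have "\<dots> = dist2 w + 2 * g * (dotp d w x - dotp d v x) + g\<^sup>2 * (\<Sum>i<d. (x i)\<^sup>2)"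
      by (simp add: sum.distrib dist2_def dotp_def sum_subtractf flip: sum_distrib_left)
    finally show ?thesis by (simp add: x)
  qed
  have w': "dist2 w' \<le> dist2 w - 2 * (\<epsilon> ^ 3 / d) * hinge 1 w z + 2 * (\<epsilon> ^ 3 / d) * hinge 1 v z + \<epsilon> ^ 4 / d"
  proof (cases "\<bar>offset x\<bar> \<le> bandwidth \<and> y * (offset x + dotp d w x) \<le> \<epsilon>")
    case True
    define k where "k = \<epsilon>\<^sup>2 / d"
    have g: "g = k * y" using True by (simp add: g_def gradient_coeff_def offset_def k_def)
    have k: "\<epsilon> ^ 3 / d = k * \<epsilon>" "0 \<le> k"
      by (auto simp: k_def power2_eq_square power3_eq_cube)
    have hw: "\<epsilon> * hinge 1 w z = \<epsilon> - y * (offset x + dotp d w x)"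
      using True \<epsilon> by (simp add: hinge_def xy max_def field_simps)
    \<comment> \<open>The loss at \<open>w\<close> equals its linear piece; at \<open>v\<close> the
      same piece is only a lower bound.\<close>
    have "\<epsilon> - y * (offset x + dotp d v x) = \<epsilon> * (1 - y * (offset x + dotp d v x) / \<epsilon>)"
      using \<epsilon> by (simp add: field_simps)
    also have "\<dots> \<le> \<epsilon> * hinge 1 v z"
      using \<epsilon> True by (intro mult_left_mono) (auto simp: hinge_def xy)
    finally have "y * (dotp d w x - dotp d v x) \<le> \<epsilon> * hinge 1 v z - \<epsilon> * hinge 1 w z"
      using hw by (simp add: algebra_simps)
    then have "2 * k * (y * (dotp d w x - dotp d v x))
        \<le> 2 * k * (\<epsilon> * hinge 1 v z - \<epsilon> * hinge 1 w z)"
      using k by (intro mult_left_mono) auto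
    moreover have "g\<^sup>2 * d = \<epsilon> ^ 4 / d"
      using y d by (auto simp: g k_def power_mult_distrib power_divide power2_eq_square power4_eq_xxxx)
    ultimately show ?thesis
      unfolding eq k by (simp add: g algebra_simps)
  next
    \<comment> \<open>Outside the band or beyond the margin no step is taken, and \<open>w\<close>
      has no loss.\<close>
    case False
    have "g = 0" using False by (auto simp: g_def gradient_coeff_def offset_def)
    moreover have "hinge 1 w z = 0"
      using False \<epsilon> by (auto simp: hinge_def xy max_def field_simps)
    ultimately show ?thesis using \<epsilon> hinge_nonneg[of 1 v z] unfolding eq by simp
  qed
  show ?thesis
  proof (cases "(\<Sum>i<d. (w' i)\<^sup>2) \<le> 4")
    case True
    then show ?thesis using w' by (simp add: next_iterate_def xy flip: g_def w'_def)
  next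
    case False
    have "dist2 (advance w z) = (\<Sum>i<d. (v i)\<^sup>2)"
      using False by (simp add: next_iterate_def xy dist2_def flip: g_def w'_def)
    \<comment> \<open>The squared length of \<open>w'\<close> exceeds 4 and that of \<open>v\<close>
      is at most 1.\<close>
    also have "\<dots> \<le> (\<Sum>i<d. (w' i)\<^sup>2) / 2 - (\<Sum>i<d. (v i)\<^sup>2)"
      using False v by linarith
    also have "\<dots> = (\<Sum>i<d. (w' i)\<^sup>2 / 2 - (v i)\<^sup>2)"
      by (simp add: sum_subtractf sum_divide_distrib)
    also have "\<dots> \<le> dist2 w'"
      unfolding dist2_def
    proof (rule sum_mono)
      fix i
      have "0 \<le> (w' i - 2 * v i)\<^sup>2" by simp
      then show "(w' i)\<^sup>2 / 2 - (v i)\<^sup>2 \<le> (w' i - v i)\<^sup>2"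
        by (simp add: power2_eq_square algebra_simps)
    qed
    finally show ?thesis using w' by linarith
  qed
qed

text \<open>A supermartingale along the run with \<open>j\<close> rounds to go; the step size is \<open>\<epsilon>\<^sup>3 / d\<close>, and
  \<open>\<epsilon>\<^sup>4 / d\<close> is the squared length of a gradient step.\<close>

definition potential :: "nat \<Rightarrow> nat \<Rightarrow> (nat \<Rightarrow> real) \<Rightarrow> (nat \<Rightarrow> real) \<Rightarrow> real" where
  "potential j m S w = 2 * (\<epsilon> ^ 3 / d) * E (hinge (real m) S) + dist2 w
     + real j * (2 * (\<epsilon> ^ 3 / d) * E (hinge 1 v) + \<epsilon> ^ 4 / d)"

lemma dist2_nonneg: "0 \<le> dist2 w"
  by (simp add: dist2_def sum_nonneg)

text \<open>Subadditivity adds the loss of the current iterate to the sum; the one-step inequality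
  pays for it by the drop in distance plus the budget of one round.\<close>

lemma potential_step:
  "E (\<lambda>z. potential j (Suc m) (\<lambda>i. S i + w i) (advance w z)) \<le> potential (Suc j) m S w"
proof -
  let ?\<eta> = "2 * (\<epsilon> ^ 3 / d)"
  let ?c = "?\<eta> * E (hinge 1 v) + \<epsilon> ^ 4 / d"
  have \<eta>: "0 \<le> ?\<eta>" using \<epsilon> by simp
  have "E (hinge (real (Suc m)) (\<lambda>i. S i + w i)) \<le> E (\<lambda>z. hinge (real m) S z + hinge 1 w z)"
    using hinge_add[of m 1 S w] by (intro expectation_mono) (simp add: add.commute)
  then have 1: "?\<eta> * E (hinge (real (Suc m)) (\<lambda>i. S i + w i)) \<le> ?\<eta> * (E (hinge (real m) S) + E (hinge 1 w))"
    using \<eta> unfolding expectation_add by (intro mult_left_mono)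
  have "E (\<lambda>z. dist2 (advance w z)) \<le> E (\<lambda>z. (dist2 w + \<epsilon> ^ 4 / d) + (?\<eta> * hinge 1 v z - ?\<eta> * hinge 1 w z))"
    using dist2_next_iterate[of _ w] by (intro expectation_mono) (simp add: algebra_simps)
  also have "\<dots> = (dist2 w + \<epsilon> ^ 4 / d) + (?\<eta> * E (hinge 1 v) - ?\<eta> * E (hinge 1 w))"
    by (simp only: expectation_add_const expectation_diff integral_mult_right_zero)
  finally have 2: "E (\<lambda>z. dist2 (advance w z)) \<le> \<dots>" .
  have "E (\<lambda>z. potential j (Suc m) (\<lambda>i. S i + w i) (advance w z))
      = ?\<eta> * E (hinge (real (Suc m)) (\<lambda>i. S i + w i)) + real j * ?c + E (\<lambda>z. dist2 (advance w z))"
    by (simp only: potential_def flip: expectation_add_const) (simp only: add_ac)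
  also have "\<dots> \<le> potential (Suc j) m S w"
  proof -
    have "real (Suc j) * ?c = real j * ?c + ?c"
      by (simp only: of_nat_Suc distrib_right[of 1] mult_1_left add.commute)
    then show ?thesis using 1 2 unfolding potential_def distrib_left by linarith
  qed
  finally show ?thesis .
qed

section \<open>The main loop\<close>

text \<open>The norm bounds keep the mean iterate in the ball of radius 2, which later controls its
  tails outside the band.\<close>

definition invariant :: "nat \<Rightarrow> state \<Rightarrow> bool" where
  "invariant m s \<longleftrightarrow> ireg s 0 = d \<and> ireg s 2 = m \<and> ireg s 3 = bandwidth \<and>
     arr s 0 0 = \<epsilon> \<and> arr s 0 1 = \<tau> \<and> arr s 2 = vhead \<and>
     (\<Sum>i<d. (arr s 4 i)\<^sup>2) \<le> 4 \<and> L2_set (arr s 3) {..<d} \<le> 2 * m"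

lemma enough_examples_iff: "invariant m s \<Longrightarrow> bval enough_examples s \<longleftrightarrow> rounds \<le> m"
proof -
  assume "invariant m s"
  then have "bval enough_examples s \<longleftrightarrow> real d \<le> real m * \<epsilon> ^ 4"
    by (simp add: enough_examples_def invariant_def power4_eq_xxxx mult.assoc)
  also have "\<dots> \<longleftrightarrow> real d / \<epsilon> ^ 4 \<le> real m" using \<epsilon> by (simp add: pos_divide_le_eq)
  finally show ?thesis unfolding rounds_def by linarith
qed

lemma update_invariant:
  assumes "invariant m s"
  shows "det D update (set_cell 6 0 (snd z) (set_arr 5 (fst z) s)) (d * 18 + 25) (\<lambda>s'. invariant (Suc m) s' \<and>
    (\<forall>i<d. arr s' 3 i = arr s 3 i + arr s 4 i) \<and> (\<forall>i<d. arr s' 4 i = advance (arr s 4) z i))"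
proof (rule det_conseq[OF det_update order_refl], goal_cases)
  case 1
  then show ?case using assms by (simp add: invariant_def)
next
  case (2 s')
  have S: "\<And>i. i < d \<Longrightarrow> arr s' 3 i = arr s 3 i + arr s 4 i"
    and w: "\<And>i. i < d \<Longrightarrow> arr s' 4 i = advance (arr s 4) z i"
    using 2 assms by (simp_all add: invariant_def)
  have "L2_set (arr s' 3) {..<d} = L2_set (\<lambda>i. arr s 3 i + arr s 4 i) {..<d}"
    using S by (intro L2_set_cong) auto
  also have "\<dots> \<le> L2_set (arr s 3) {..<d} + L2_set (arr s 4) {..<d}" by (rule L2_set_triangle_ineq)
  also have "L2_set (arr s 4) {..<d} \<le> sqrt 4"
    unfolding L2_set_def using assms by (intro real_sqrt_le_mono) (simp add: invariant_def)
  finally have "L2_set (arr s' 3) {..<d} \<le> 2 * Suc m" using assms by (simp add: invariant_def)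
  moreover have "(\<Sum>i<d. (arr s' 4 i)\<^sup>2) \<le> 4"
    using next_iterate_norm[of "real bandwidth" "arr s 4" "fst z" "snd z"] w by simp
  moreover have "ireg s' 0 = d" "ireg s' 2 = Suc m" "ireg s' 3 = bandwidth"
    "arr s' 0 = arr s 0" "arr s' 2 = arr s 2"
    using 2 assms by (simp_all add: invariant_def)
  ultimately have "invariant (Suc m) s'" using assms by (simp add: invariant_def)
  then show ?case using S w by blast
qed

lemma potential_cong:
  assumes "\<And>i. i < d \<Longrightarrow> S i = S' i" "\<And>i. i < d \<Longrightarrow> w i = w' i"
  shows "potential j m S w = potential j m S' w'"
proof -
  have "hinge (real m) S = hinge (real m) S'" using assms(1) by (intro ext hinge_cong)
  then show ?thesis using assms(2) by (simp add: potential_def dist2_def)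
qed

lemma potential_nonneg: "0 \<le> potential j m S w"
  unfolding potential_def using \<epsilon> dist2_nonneg
  by (intro add_nonneg_nonneg mult_nonneg_nonneg integral_nonneg) (auto simp: hinge_nonneg)

text \<open>Markov's inequality carried through the program: the normalised potential is at least 1
  when a run ends badly and does not grow in expectation over a round.\<close>

lemma main_loop:
  fixes \<theta> :: real
  assumes \<theta>: "0 < \<theta>"
    and good: "\<And>S s. L2_set S {..<d} \<le> 2 * rounds \<Longrightarrow> E (hinge rounds S) < rounds * \<theta> \<Longrightarrow>
      (\<And>i. i < d \<Longrightarrow> arr s 3 i = vhead i + S i / rounds) \<Longrightarrow> \<not> Bad s"
    and "invariant m s" "m + j = rounds"
  shows "halts_with D (j * (d * 18 + 28) + (d * 4 + 4))
    ([While (BNot enough_examples) (Seq (Sample 5 6) update), average], s) Bad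
    (potential j m (arr s 3) (arr s 4) / (2 * (\<epsilon> ^ 3 / d) * rounds * \<theta>))"
  using assms(3,4)
proof (induction j arbitrary: m s)
  case 0
  let ?c = "2 * (\<epsilon> ^ 3 / d) * rounds * \<theta>"
  have "real d / \<epsilon> ^ 4 > 0" using d \<epsilon> by simp
  then have r: "rounds > 0" unfolding rounds_def by linarith
  have m: "m = rounds" using 0 by simp
  have "halts_with D ((d * 4 + 3) + 0) ([average], s) Bad (potential 0 m (arr s 3) (arr s 4) / ?c)"
  proof (rule halts_with_det[OF det_average])
    show "ireg s 0 = d" using 0 by (simp add: invariant_def)
    fix s' :: state assume s': "\<forall>i<d. arr s' 3 i = arr s 2 i + arr s 3 i / real (ireg s 2)"
    show "halts_with D 0 ([], s') Bad (potential 0 m (arr s 3) (arr s 4) / ?c)"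
    proof (rule halts_with_return)
      have c: "?c > 0" using \<epsilon> d r \<theta> by simp
      show "(if Bad s' then 1 else 0) \<le> potential 0 m (arr s 3) (arr s 4) / ?c"
      proof (cases "Bad s'")
        case True
        have "\<not> E (hinge rounds (arr s 3)) < rounds * \<theta>"
          using good[of "arr s 3" s'] True s' 0 m by (auto simp: invariant_def)
        then have "2 * (\<epsilon> ^ 3 / d) * (rounds * \<theta>) \<le> 2 * (\<epsilon> ^ 3 / d) * E (hinge rounds (arr s 3))"
          using \<epsilon> by (intro mult_left_mono) auto
        also have "\<dots> \<le> potential 0 m (arr s 3) (arr s 4)"
          unfolding potential_def m using dist2_nonneg by simp
        finally have "?c \<le> potential 0 m (arr s 3) (arr s 4)" by (simp only: mult.assoc)
        then show ?thesis using True c by (simp only: le_divide_eq_1_pos if_True)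
      next
        case False
        then show ?thesis using potential_nonneg c by (simp only: if_False divide_nonneg_pos)
      qed
    qed
  qed
  then have "halts_with D (Suc (d * 4 + 3))
      ([While (BNot enough_examples) (Seq (Sample 5 6) update), average], s) Bad
      (potential 0 m (arr s 3) (arr s 4) / ?c)"
    using enough_examples_iff[OF 0(1)] m by (intro halts_with_While) simp
  then show ?case by (simp add: algebra_simps)
next
  case (Suc j)
  let ?c = "2 * (\<epsilon> ^ 3 / d) * rounds * \<theta>"
  let ?loop = "While (BNot enough_examples) (Seq (Sample 5 6) update)"
  let ?t = "j * (d * 18 + 28) + (d * 4 + 4)"
  let ?p = "\<lambda>z. potential j (Suc m) (\<lambda>i. arr s 3 i + arr s 4 i) (advance (arr s 4) z) / ?c"
  have c: "?c \<ge> 0" using \<epsilon> \<theta> by simp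
  have body: "halts_with D ((d * 18 + 25) + ?t) ([update, ?loop, average], set_cell 6 0 (snd z) (set_arr 5 (fst z) s)) Bad (?p z)"
    for z
  proof (rule halts_with_det[OF update_invariant[OF Suc.prems(1)]])
    fix s' :: state assume s': "invariant (Suc m) s' \<and> (\<forall>i<d. arr s' 3 i = arr s 3 i + arr s 4 i) \<and>
      (\<forall>i<d. arr s' 4 i = advance (arr s 4) z i)"
    then have "halts_with D ?t ([?loop, average], s') Bad (potential j (Suc m) (arr s' 3) (arr s' 4) / ?c)"
      using Suc.prems(2) by (intro Suc.IH) auto
    also have "potential j (Suc m) (arr s' 3) (arr s' 4)
        = potential j (Suc m) (\<lambda>i. arr s 3 i + arr s 4 i) (advance (arr s 4) z)"
      using s' by (intro potential_cong) auto
    finally show "halts_with D ?t ([?loop, average], s') Bad (?p z)" .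
  qed
  have "halts_with D (Suc ((d * 18 + 25) + ?t)) ([Sample 5 6, update, ?loop, average], s) Bad (E ?p)"
    by (rule halts_with_Sample[OF finite_supp body])
  then have "halts_with D (Suc ((d * 18 + 25) + ?t)) ([Sample 5 6, update, ?loop, average], s) Bad
      (potential (Suc j) m (arr s 3) (arr s 4) / ?c)"
    by (rule halts_with_mono)
       (simp only: integral_divide_zero, rule divide_right_mono[OF potential_step c])
  then have "halts_with D (Suc (Suc ((d * 18 + 25) + ?t))) ([Seq (Sample 5 6) update, ?loop, average], s) Bad
      (potential (Suc j) m (arr s 3) (arr s 4) / ?c)"
    by (rule halts_with_Seq)
  \<comment> \<open>Draw, sequencing and guard add 3 steps to the update.\<close>
  then have "halts_with D (Suc (Suc (Suc ((d * 18 + 25) + ?t)))) ([?loop, average], s) Bad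
      (potential (Suc j) m (arr s 3) (arr s 4) / ?c)"
    using enough_examples_iff[OF Suc.prems(1)] Suc.prems(2)
    by (intro halts_with_While) simp
  then show ?case by (simp add: algebra_simps)
qed

section \<open>Bandwidth, failure probability and running time\<close>

lemma rounds_pos: "0 < rounds"
proof -
  have "real d / \<epsilon> ^ 4 > 0" using d \<epsilon> by simp
  then show ?thesis unfolding rounds_def by linarith
qed

lemma two_power_bandwidth: "1 \<le> 2 ^ bandwidth * \<epsilon>"
proof -
  obtain k where "1 / \<epsilon> < 2 ^ k" using real_arch_pow[of 2 "1 / \<epsilon>"] by auto
  then have "1 \<le> 2 ^ k * \<epsilon>" using \<epsilon> by (simp add: field_simps)
  then show ?thesis unfolding bandwidth_def by (rule LeastI)
qed

lemma exp_bandwidth_le: "exp (- real bandwidth) \<le> \<epsilon>"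
proof -
  have "2 \<le> exp (1 :: real)" using exp_ge_add_one_self[of 1] by simp
  then have "2 ^ bandwidth \<le> exp (1 :: real) ^ bandwidth" by (intro power_mono) auto
  also have "\<dots> = exp (real bandwidth)" by (simp flip: exp_of_nat_mult)
  finally have "2 ^ bandwidth * \<epsilon> \<le> exp (real bandwidth) * \<epsilon>" using \<epsilon> by (intro mult_right_mono) auto
  then have "1 \<le> exp (real bandwidth) * \<epsilon>" using two_power_bandwidth by linarith
  then show ?thesis by (simp add: exp_minus field_simps)
qed

text \<open>Minimality of the bandwidth; under truncated subtraction the case 0 reads
  \<open>\<epsilon> < 1\<close>.\<close>

lemma two_power_bandwidth_minus: "2 ^ (bandwidth - 1) * \<epsilon> < 1"
proof (cases bandwidth)
  case (Suc k)
  then have "\<not> 1 \<le> 2 ^ k * \<epsilon>" using not_less_Least[of k "\<lambda>k. 1 \<le> 2 ^ k * \<epsilon>"] by (simp add: bandwidth_def)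
  then show ?thesis using Suc by simp
qed (use \<epsilon> in simp)

text \<open>The initial potential is at most
  \<open>2 * (\<epsilon>^3 / d) * rounds * \<theta>\<close>, so the threshold
  \<open>200 * \<theta>\<close> is reached with probability at most 1/200.\<close>

lemma learner_halts:
  fixes \<theta> :: real
  assumes \<theta>: "E (hinge 1 v) + \<epsilon> \<le> \<theta>"
    and good: "\<And>S s. L2_set S {..<d} \<le> 2 * rounds \<Longrightarrow> E (hinge rounds S) < rounds * (200 * \<theta>) \<Longrightarrow>
      (\<And>i. i < d \<Longrightarrow> arr s 3 i = vhead i + S i / rounds) \<Longrightarrow> \<not> Bad s"
  shows "halts_with D (bandwidth * 5 + rounds * (d * 18 + 28) + (d * 4 + 9))
    ([learner], init_state \<epsilon> d H vhead \<tau>) Bad (1 / 200)"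
proof -
  let ?s = "init_state \<epsilon> d H vhead \<tau>"
  let ?t = "rounds * (d * 18 + 28) + (d * 4 + 4)"
  let ?loop = "While (BNot enough_examples) (Seq (Sample 5 6) update)"
  have hv: "0 \<le> E (hinge 1 v)" by (simp add: hinge_nonneg integral_nonneg)
  then have \<theta>0: "0 < \<theta>" using \<theta> \<epsilon> by linarith
  have loop: "halts_with D ?t ([?loop, average], s) Bad (1 / 200)"
    if s: "(\<forall>r. r \<noteq> 3 \<longrightarrow> ireg s r = ireg ?s r) \<and> ireg s 3 = bandwidth \<and> (\<forall>a. a \<noteq> 7 \<longrightarrow> arr s a = arr ?s a)" for s
  proof -
    have inv: "invariant 0 s"
      using s by (simp add: invariant_def init_state_def L2_set_def)
    have "halts_with D ?t ([?loop, average], s) Bad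
      (potential rounds 0 (arr s 3) (arr s 4) / (2 * (\<epsilon> ^ 3 / d) * rounds * (200 * \<theta>)))"
      by (rule main_loop[OF _ good inv]) (use \<theta>0 in auto)
    moreover have "potential rounds 0 (arr s 3) (arr s 4) / (2 * (\<epsilon> ^ 3 / d) * rounds * (200 * \<theta>)) \<le> 1 / 200"
    proof -
      let ?\<eta> = "\<epsilon> ^ 3 / d"
      \<comment> \<open>The homogenised loss of the empty sum vanishes.\<close>
      have "hinge 0 (arr s 3) = (\<lambda>_. 0)"
        using s by (intro ext) (simp add: hinge_def init_state_def dotp_def)
      then have "potential rounds 0 (arr s 3) (arr s 4)
          = dist2 (arr s 4) + rounds * (2 * ?\<eta> * E (hinge 1 v) + \<epsilon> ^ 4 / d)"
        by (simp add: potential_def)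
      also have "dist2 (arr s 4) = (\<Sum>i<d. (v i)\<^sup>2)"
        using s by (simp add: dist2_def init_state_def)
      also have "\<dots> \<le> real rounds * (\<epsilon> ^ 4 / d)"
      proof -
        have "real d / \<epsilon> ^ 4 \<le> rounds" unfolding rounds_def by linarith
        then have "real d \<le> rounds * \<epsilon> ^ 4" using \<epsilon> by (simp add: pos_divide_le_eq)
        then have "1 \<le> real rounds * (\<epsilon> ^ 4 / d)" using d by (simp add: field_simps)
        then show ?thesis using v by linarith
      qed
      \<comment> \<open>Initial distance and step lengths each contribute
        \<open>\<epsilon>^4 / d\<close> per round, which is the step size times \<epsilon>.\<close>
      also have "real rounds * (\<epsilon> ^ 4 / d) + rounds * (2 * ?\<eta> * E (hinge 1 v) + \<epsilon> ^ 4 / d)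
          = 2 * ?\<eta> * rounds * (E (hinge 1 v) + \<epsilon>)"
        by (simp add: algebra_simps add_divide_distrib power4_eq_xxxx power3_eq_cube)
      also have "\<dots> \<le> 2 * ?\<eta> * rounds * \<theta>" using \<theta> \<epsilon> by (intro mult_left_mono) auto
      finally have "potential rounds 0 (arr s 3) (arr s 4) \<le> 2 * ?\<eta> * rounds * \<theta>" by simp
      moreover define b where "b = 2 * ?\<eta> * rounds * \<theta>"
      moreover have "0 < b" unfolding b_def using \<epsilon> d rounds_pos \<theta>0 by simp
      moreover have "2 * ?\<eta> * rounds * (200 * \<theta>) = 200 * b" by (simp add: b_def)
      ultimately show ?thesis by (simp only: pos_divide_le_eq) (simp add: field_simps)
    qed
    ultimately show ?thesis by (rule halts_with_mono)
  qed
  have "halts_with D ((bandwidth * 5 + 3) + Suc ?t) ([halvings, Seq ?loop average], ?s) Bad (1 / 200)"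
  proof (rule halts_with_det)
    show "det D halvings ?s (bandwidth * 5 + 3) (\<lambda>s. (\<forall>r. r \<noteq> 3 \<longrightarrow> ireg s r = ireg ?s r) \<and>
        ireg s 3 = bandwidth \<and> (\<forall>a. a \<noteq> 7 \<longrightarrow> arr s a = arr ?s a))"
      by (rule det_halvings) (use \<epsilon> in \<open>simp_all add: init_state_def bandwidth_def\<close>)
  qed (intro halts_with_Seq loop)
  then have "halts_with D (Suc ((bandwidth * 5 + 3) + Suc ?t)) ([learner], ?s) Bad (1 / 200)"
    unfolding learner_def by (rule halts_with_Seq)
  then show ?thesis by (simp add: algebra_simps)
qed

text \<open>With \<open>z = d / \<epsilon>\<close>, the bandwidth is at most \<open>2 * z\<close>
  and \<open>rounds\<close> at most \<open>2 * z^4\<close>. The loop costs \<open>92 * z^5\<close>,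
  the rest \<open>23 * z\<close>.\<close>

lemma run_time:
  "real (bandwidth * 5 + rounds * (d * 18 + 28) + (d * 4 + 9)) \<le> poly (monom 115 5) (real d / \<epsilon>)"
proof -
  define z where "z = real d / \<epsilon>"
  have z: "real d \<le> z" "1 / \<epsilon> \<le> z" using d \<epsilon> by (auto simp: z_def field_simps)
  have d1: "1 \<le> real d" using d by simp
  have z1: "1 \<le> z" using z(1) d1 by linarith
  have "2 ^ (bandwidth - 1) < 1 / \<epsilon>" using two_power_bandwidth_minus \<epsilon> by (simp add: field_simps)
  moreover have "real (bandwidth - 1) < 2 ^ (bandwidth - 1)" by (rule of_nat_less_two_power)
  ultimately have K: "real bandwidth \<le> 2 * z" using z z1 by linarith
  have "real d / \<epsilon> ^ 4 \<le> z ^ 4"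
  proof -
    have "real d ^ 1 \<le> real d ^ 4" by (rule power_increasing) (use d1 in auto)
    then show ?thesis using \<epsilon> by (simp add: z_def power_divide divide_right_mono)
  qed
  moreover have "1 \<le> z ^ 4" using z1 by simp
  moreover have "real rounds \<le> real d / \<epsilon> ^ 4 + 1"
  proof -
    have "0 \<le> real d / \<epsilon> ^ 4" using \<epsilon> by simp
    then show ?thesis unfolding rounds_def by linarith
  qed
  ultimately have n: "real rounds \<le> 2 * z ^ 4" by linarith
  have "real (bandwidth * 5 + rounds * (d * 18 + 28) + (d * 4 + 9))
    = real bandwidth * 5 + real rounds * (real d * 18 + 28) + (real d * 4 + 9)" by simp
  also have "\<dots> \<le> (2 * z) * 5 + (2 * z ^ 4) * (z * 18 + 28 * z) + (z * 4 + 9 * z)"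
    using K n z z1 by (intro add_mono mult_mono) auto
  also have "\<dots> = 23 * z + 92 * z ^ 5" by (simp add: eval_nat_numeral)
  also have "\<dots> \<le> 115 * z ^ 5" using power_increasing[of 1 5 z] z1 by simp
  finally show ?thesis by (simp add: poly_monom z_def)
qed

end

section \<open>Comparison with a regular vector\<close>

text \<open>As the supports of head and comparator are disjoint, adding the head leaves the nonzero
  coordinates of \<open>v\<close> intact, as \<open>small_ball\<close> requires.\<close>

locale regular_halfspace = noisy_halfspace +
  assumes unit: "(\<Sum>i<d. (v i)\<^sup>2) = 1" and regular: "(\<Sum>i<d. (v i) ^ 4) \<le> \<epsilon>\<^sup>2"
    and disjoint: "\<And>i. i < d \<Longrightarrow> v i \<noteq> 0 \<Longrightarrow> vhead i = 0"
    and uniform: "map_pmf fst D = pmf_of_set (cube d)"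
begin

definition opt :: real where "opt = err D (\<lambda>x. dotp d vhead x + dotp d v x + \<tau>)"

lemma opt_eq: "opt = E (\<lambda>z. of_bool (sign (offset (fst z) + dotp d v (fst z)) \<noteq> snd z))"
proof -
  have "opt = E (indicator {(x, y). sign (dotp d vhead x + dotp d v x + \<tau>) \<noteq> y})"
    by (simp add: opt_def err_def)
  also have "\<dots> = E (\<lambda>z. of_bool (sign (offset (fst z) + dotp d v (fst z)) \<noteq> snd z))"
    by (intro Bochner_Integration.integral_cong) (auto simp: offset_def indicator_def add_ac)
  finally show ?thesis .
qed

lemma marginal:
  fixes f :: "_ \<Rightarrow> real"
  shows "E (\<lambda>z. f (fst z)) = measure_pmf.expectation (pmf_of_set (cube d)) f"
  by (simp flip: uniform)

lemma marginal_prob: "E (\<lambda>z. of_bool (P (fst z))) = measure_pmf.prob (pmf_of_set (cube d)) {x. P x}"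
proof -
  have "(\<lambda>x. of_bool (P x) :: real) = indicator {x. P x}" by (auto simp: indicator_def)
  then show ?thesis using marginal[of "\<lambda>x. of_bool (P x)"] by simp
qed

text \<open>Correctly classified points lose at most 1, and only within \<epsilon> of the boundary.
  Misclassified ones lose \<open>1 + |a| / \<epsilon>\<close>, where \<open>|a|\<close> is at most
  twice the bandwidth up to a tail term of \<open>dotp d v x\<close>.\<close>

lemma hinge_regular_le:
  "E (hinge 1 v) \<le> (14 + 2 * exp (9 / 2)) * \<epsilon> + (1 + 2 * real bandwidth / \<epsilon>) * opt"
proof -
  let ?K = "real bandwidth"
  let ?near = "\<lambda>x. \<bar>dotp d (\<lambda>i. vhead i + v i) x + \<tau>\<bar> \<le> \<epsilon>"
  let ?wrong = "\<lambda>z. sign (offset (fst z) + dotp d v (fst z)) \<noteq> snd z"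
  let ?tail = "\<lambda>x. \<bar>dotp d v x\<bar> * indicator {x. \<bar>dotp d v x\<bar> > ?K} x"
  have "E (hinge 1 v) \<le> E (\<lambda>z. of_bool (?near (fst z)) + ((1 + 2 * ?K / \<epsilon>) * of_bool (?wrong z)
      + (1 / \<epsilon>) * ?tail (fst z)))"
  proof (rule expectation_mono)
    fix z assume "z \<in> set_pmf D"
    then have y: "snd z = -1 \<or> snd z = 1" using supp by (cases z) auto
    define a where "a = offset (fst z) + dotp d v (fst z)"
    have near: "dotp d (\<lambda>i. vhead i + v i) (fst z) + \<tau> = a"
      by (simp add: a_def offset_def dotp_add)
    have t0: "0 \<le> (1 / \<epsilon>) * ?tail (fst z)" using \<epsilon> by (simp add: indicator_def)
    have K0: "0 \<le> (1 + 2 * ?K / \<epsilon>)" using \<epsilon> by simp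
    show "hinge 1 v z \<le> of_bool (?near (fst z)) + ((1 + 2 * ?K / \<epsilon>) * of_bool (?wrong z) + (1 / \<epsilon>) * ?tail (fst z))"
    proof (cases "\<bar>offset (fst z)\<bar> \<le> ?K")
      case False
      then show ?thesis using t0 K0 by (simp add: hinge_def)
    next
      case True
      then have h: "hinge 1 v z = max 0 (1 - snd z * a / \<epsilon>)" by (simp add: hinge_def a_def)
      show ?thesis
      proof (cases "sign a = snd z")
        case True
        then have "snd z = sign a" by simp
        then have "snd z * a = \<bar>a\<bar>" by (simp add: sign_def abs_if)
        then have "hinge 1 v z \<le> of_bool (?near (fst z))"
          unfolding h near using \<epsilon> by (auto simp: field_simps)
        then show ?thesis using t0 True by (simp add: a_def)
      next
        case False
        then have "snd z * a = - \<bar>a\<bar>" using y by (auto simp: sign_def split: if_splits)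
        then have "hinge 1 v z = 1 + \<bar>a\<bar> / \<epsilon>" unfolding h using \<epsilon> by simp
        moreover have "\<bar>a\<bar> \<le> 2 * ?K + ?tail (fst z)"
          using \<open>\<bar>offset (fst z)\<bar> \<le> ?K\<close> by (auto simp: a_def indicator_def)
        then have "\<bar>a\<bar> / \<epsilon> \<le> (2 * ?K + ?tail (fst z)) / \<epsilon>" using \<epsilon> by (intro divide_right_mono) auto
        ultimately show ?thesis using False by (simp add: a_def add_divide_distrib)
      qed
    qed
  qed
  also have "\<dots> = measure_pmf.prob (pmf_of_set (cube d)) {x. ?near x}
      + ((1 + 2 * ?K / \<epsilon>) * opt + (1 / \<epsilon>) * measure_pmf.expectation (pmf_of_set (cube d)) ?tail)"
    by (simp only: expectation_add integral_mult_right_zero opt_eq marginal_prob[of ?near] marginal[of ?tail])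
  also have "measure_pmf.prob (pmf_of_set (cube d)) {x. ?near x} \<le> 14 * \<epsilon>"
    by (rule small_ball[OF \<epsilon>(1) unit regular]) (use disjoint in auto)
  also have "measure_pmf.expectation (pmf_of_set (cube d)) ?tail \<le> 2 * exp (9 / 2) * \<epsilon>\<^sup>2"
  proof -
    have "measure_pmf.expectation (pmf_of_set (cube d)) ?tail \<le> 2 * exp (9 * 1 / 2 - 2 * ?K)"
      by (rule cube_tail_expectation) (simp add: unit)
    also have "\<dots> = 2 * exp (9 / 2) * (exp (- ?K))\<^sup>2"
      by (simp add: mult_exp_exp flip: exp_double)
    also have "\<dots> \<le> 2 * exp (9 / 2) * \<epsilon>\<^sup>2"
      using exp_bandwidth_le by (intro mult_left_mono power_mono) auto
    finally show ?thesis .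
  qed
  finally have "E (hinge 1 v) \<le> 14 * \<epsilon> + ((1 + 2 * ?K / \<epsilon>) * opt + 1 / \<epsilon> * (2 * exp (9 / 2) * \<epsilon>\<^sup>2))"
    using \<epsilon> by (simp add: divide_right_mono)
  then show ?thesis using \<epsilon> by (simp add: algebra_simps power2_eq_square)
qed

text \<open>In the band the hinge loss of the mean iterate dominates its error. Outside, barring a
  tail event for \<open>w\<close> or \<open>v\<close>, both halfspaces follow the sign of the
  offset, so an error is also an error of \<open>v\<close>.\<close>

lemma err_average_le:
  fixes \<theta> :: real
  assumes S: "L2_set S {..<d} \<le> 2 * rounds" and h: "E (hinge rounds S) < rounds * \<theta>"
  shows "err D (\<lambda>x. dotp d (\<lambda>i. vhead i + S i / rounds) x + \<tau>) \<le> \<theta> + opt + 4 * exp 2 * \<epsilon>"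
proof -
  let ?K = "real bandwidth"
  define w where "w = (\<lambda>i. 1 / real rounds * S i)"
  have w4: "(\<Sum>i<d. (w i)\<^sup>2) \<le> 4"
  proof -
    have "L2_set w {..<d} = 1 / rounds * L2_set S {..<d}"
      unfolding w_def by (rule L2_set_right_distrib[symmetric]) simp
    also have "\<dots> \<le> 2" using S rounds_pos by (simp add: field_simps)
    finally have "(L2_set w {..<d})\<^sup>2 \<le> 2\<^sup>2" by (intro power_mono) auto
    then show ?thesis by (simp add: L2_set_def sum_nonneg)
  qed
  have hw: "E (hinge 1 w) \<le> \<theta>"
  proof -
    have "hinge 1 w = (\<lambda>z. 1 / rounds * hinge rounds S z)"
      using hinge_scale[of "1 / rounds" rounds S] rounds_pos by (intro ext) (simp add: w_def)
    then have "E (hinge 1 w) = E (\<lambda>z. 1 / rounds * hinge rounds S z)" by simp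
    also have "\<dots> = 1 / rounds * E (hinge rounds S)" by simp
    also have "\<dots> \<le> \<theta>" using h rounds_pos by (simp add: field_simps)
    finally show ?thesis .
  qed
  let ?wrong = "\<lambda>z. sign (offset (fst z) + dotp d v (fst z)) \<noteq> snd z"
  let ?far = "\<lambda>u x. \<bar>dotp d u x\<bar> > ?K"
  have "err D (\<lambda>x. dotp d (\<lambda>i. vhead i + S i / rounds) x + \<tau>)
      = E (indicator {(x, y). sign (offset x + dotp d w x) \<noteq> y})"
    using dotp_add[of d vhead w] by (simp add: err_def w_def offset_def add_ac)
  also have "\<dots> \<le> E (\<lambda>z. hinge 1 w z + (of_bool (?wrong z) + (of_bool (?far w (fst z)) + of_bool (?far v (fst z)))))"
  proof (rule expectation_mono)
    fix z assume "z \<in> set_pmf D"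
    then have y: "snd z = -1 \<or> snd z = 1" using supp by (cases z) auto
    show "indicator {(x, y). sign (offset x + dotp d w x) \<noteq> y} z
        \<le> hinge 1 w z + (of_bool (?wrong z) + (of_bool (?far w (fst z)) + of_bool (?far v (fst z))))"
    proof (cases "sign (offset (fst z) + dotp d w (fst z)) = snd z")
      case True
      then show ?thesis using hinge_nonneg[of 1 w z] by (auto simp: indicator_def split: prod.splits)
    next
      case False
      show ?thesis
      proof (cases "\<bar>offset (fst z)\<bar> \<le> ?K")
        case True
        have "snd z * (offset (fst z) + dotp d w (fst z)) \<le> 0"
          using False y by (auto simp: sign_def split: if_splits)
        then have "snd z * (offset (fst z) + dotp d w (fst z)) / \<epsilon> \<le> 0"
          using \<epsilon> by (simp add: divide_nonpos_pos)
        then have "1 \<le> hinge 1 w z" using True by (simp add: hinge_def)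
        then show ?thesis by (auto simp: indicator_def split: prod.splits)
      next
        case out: False
        then have "?wrong z \<or> ?far w (fst z) \<or> ?far v (fst z)"
          using False by (auto simp: sign_def abs_if split: if_splits)
        then show ?thesis using hinge_nonneg[of 1 w z] by (auto simp: indicator_def split: prod.splits)
      qed
    qed
  qed
  also have "\<dots> = E (hinge 1 w) + (opt + (measure_pmf.prob (pmf_of_set (cube d)) {x. ?far w x}
      + measure_pmf.prob (pmf_of_set (cube d)) {x. ?far v x}))"
    by (simp only: expectation_add opt_eq marginal_prob[of "?far _"])
  also have "\<dots> \<le> \<theta> + (opt + (2 * exp (4 / 2 - ?K) + 2 * exp (4 / 2 - ?K)))"
    using v by (intro add_mono hw order_refl cube_tail w4) auto
  also have "exp (4 / 2 - ?K) = exp 2 * exp (- ?K)" by (simp add: mult_exp_exp)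
  also have "\<theta> + (opt + (2 * (exp 2 * exp (- ?K)) + 2 * (exp 2 * exp (- ?K))))
      \<le> \<theta> + opt + 4 * exp 2 * \<epsilon>"
    using mult_left_mono[OF exp_bandwidth_le, of "4 * exp 2"] by simp
  finally show ?thesis .
qed

text \<open>For \<epsilon> at most 1/2 the logarithm is at least 1/2 and absorbs additive constants;
  larger \<epsilon> make the final error bound trivial.\<close>

lemma bandwidth_le_ln:
  assumes "\<epsilon> \<le> 1 / 2"
  shows "1 + 2 * real bandwidth / \<epsilon> \<le> 10 * (ln (1 / \<epsilon>) / \<epsilon>)" "1 \<le> 2 * (ln (1 / \<epsilon>) / \<epsilon>)"
proof -
  have ln2: "1 / 2 \<le> ln (2 :: real)" using ln_le_minus_one[of "1 / 2 :: real"] by (simp add: ln_div)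
  have "ln 2 \<le> ln (1 / \<epsilon>)" using assms \<epsilon> by (subst ln_le_cancel_iff) (auto simp: field_simps)
  then have l: "1 / 2 \<le> ln (1 / \<epsilon>)" using ln2 by linarith
  have "2 ^ (bandwidth - 1) < 1 / \<epsilon>" using two_power_bandwidth_minus \<epsilon> by (simp add: field_simps)
  then have "ln (2 ^ (bandwidth - 1)) < ln (1 / \<epsilon>)" using \<epsilon> by (subst ln_less_cancel_iff) auto
  then have "real (bandwidth - 1) * ln 2 < ln (1 / \<epsilon>)" by (simp add: ln_realpow)
  moreover have "real (bandwidth - 1) * (1 / 2) \<le> real (bandwidth - 1) * ln 2"
    using ln2 by (intro mult_left_mono) auto
  ultimately have K: "real bandwidth \<le> 4 * ln (1 / \<epsilon>)" using l by linarith
  have "\<epsilon> \<le> 2 * ln (1 / \<epsilon>)" using assms l by linarith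
  then show "1 \<le> 2 * (ln (1 / \<epsilon>) / \<epsilon>)" using \<epsilon> by (simp add: field_simps)
  moreover have "real bandwidth / \<epsilon> \<le> 4 * ln (1 / \<epsilon>) / \<epsilon>" using K \<epsilon> by (intro divide_right_mono) auto
  ultimately show "1 + 2 * real bandwidth / \<epsilon> \<le> 10 * (ln (1 / \<epsilon>) / \<epsilon>)" by simp
qed

end

lemma regular_vecs_D:
  assumes "v \<in> regular_vecs d H \<epsilon>"
  shows "(\<Sum>i<d. (v i)\<^sup>2) = 1" "(\<Sum>i<d. (v i) ^ 4) \<le> \<epsilon>\<^sup>2" "i \<in> H \<Longrightarrow> v i = 0"
proof -
  show "(\<Sum>i<d. (v i)\<^sup>2) = 1"
    using assms by (simp add: regular_vecs_def pnorm_def)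
  have "(\<Sum>i<d. (v i) ^ 4) = (pnorm d 4 v) ^ 4"
    by (simp add: pnorm_def sum_nonneg)
  also have "\<dots> = ((pnorm d 4 v)\<^sup>2)\<^sup>2" by simp
  also have "\<dots> \<le> \<epsilon>\<^sup>2" using assms by (intro power_mono) (auto simp: regular_vecs_def)
  finally show "(\<Sum>i<d. (v i) ^ 4) \<le> \<epsilon>\<^sup>2" .
  show "i \<in> H \<Longrightarrow> v i = 0" using assms by (simp add: regular_vecs_def)
qed

lemma opt_reg_nonneg: "0 \<le> opt_reg d H \<epsilon> vhead \<tau> D"
  unfolding opt_reg_def by (intro INF_greatest) (simp add: err_def)

section \<open>The final constant and the assembled bound\<close>

text \<open>The sum of both final coefficients: 2002 = 200 * 10 + 2 belongs to the logarithmic term,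
  the rest to \<epsilon>, with 15 = 14 + 1.\<close>

definition err_const :: real where "err_const = 200 * (15 + 2 * exp (9 / 2)) + 4 * exp 2 + 2002"

lemma err_const_ge: "2002 \<le> err_const"
  by (simp add: err_const_def add_nonneg_nonneg)

context regular_halfspace
begin

lemma learner_err:
  assumes small: "\<epsilon> \<le> 1 / 2"
  shows "halts_with D (bandwidth * 5 + rounds * (d * 18 + 28) + (d * 4 + 9))
    ([learner], init_state \<epsilon> d H vhead \<tau>)
    (\<lambda>s. \<not> err D (\<lambda>x. dotp d (arr s 3) x + \<tau>) \<le> err_const * (opt / \<epsilon> * ln (1 / \<epsilon>) + \<epsilon>)) (1 / 200)"
proof (rule learner_halts[OF order_refl])
  fix S :: "nat \<Rightarrow> real" and s :: state
  assume S: "L2_set S {..<d} \<le> 2 * rounds"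
    "E (hinge rounds S) < rounds * (200 * (E (hinge 1 v) + \<epsilon>))"
    "\<And>i. i < d \<Longrightarrow> arr s 3 i = vhead i + S i / rounds"
  define l where "l = ln (1 / \<epsilon>) / \<epsilon>"
  have opt0: "0 \<le> opt" by (simp add: opt_def err_def)
  have "dotp d (arr s 3) = dotp d (\<lambda>i. vhead i + S i / rounds)"
    using S(3) by (intro ext dotp_cong)
  then have "err D (\<lambda>x. dotp d (arr s 3) x + \<tau>) \<le> 200 * (E (hinge 1 v) + \<epsilon>) + opt + 4 * exp 2 * \<epsilon>"
    using err_average_le[OF S(1,2)] by simp
  \<comment> \<open>Both the factor \<open>1 + 2 * bandwidth / \<epsilon>\<close> and the bare
    \<open>opt\<close> are turned into multiples of \<open>l\<close>.\<close>
  also have "\<dots> \<le> 200 * ((14 + 2 * exp (9 / 2)) * \<epsilon> + (10 * l) * opt + \<epsilon>) + (2 * l) * opt + 4 * exp 2 * \<epsilon>"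
  proof (intro add_mono mult_left_mono order_refl)
    show "E (hinge 1 v) \<le> (14 + 2 * exp (9 / 2)) * \<epsilon> + (10 * l) * opt"
      unfolding l_def
      by (rule order_trans[OF hinge_regular_le add_left_mono])
         (rule mult_right_mono[OF bandwidth_le_ln(1)[OF small] opt0])
    show "opt \<le> (2 * l) * opt"
      unfolding l_def using mult_right_mono[OF bandwidth_le_ln(2)[OF small] opt0] by simp
  qed (auto intro!: mult_nonneg_nonneg)
  also have "\<dots> = 2002 * (l * opt) + (200 * (15 + 2 * exp (9 / 2)) + 4 * exp 2) * \<epsilon>"
    by (simp add: algebra_simps)
  also have "\<dots> \<le> err_const * (l * opt) + err_const * \<epsilon>"
  proof (intro add_mono mult_right_mono)
    have "0 \<le> l" using bandwidth_le_ln(2)[OF small] unfolding l_def by linarith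
    then show "0 \<le> l * opt" using opt0 by (rule mult_nonneg_nonneg)
  qed (use \<epsilon> in \<open>auto simp: err_const_def add_nonneg_nonneg\<close>)
  finally show "\<not> \<not> err D (\<lambda>x. dotp d (arr s 3) x + \<tau>) \<le> err_const * (opt / \<epsilon> * ln (1 / \<epsilon>) + \<epsilon>)"
    by (simp add: l_def algebra_simps)
qed

end

theorem theorem6p1:
  "\<exists>(FindRegularCoefficients :: com) (p :: real poly) (C :: real). C > 0 \<and>
     (\<forall>(\<epsilon> :: real) (d :: nat) (H :: nat set) (vhead :: nat \<Rightarrow> real) (\<tau> :: real)
        (D :: ((nat \<Rightarrow> real) \<times> real) pmf).
        0 < \<epsilon> \<and> \<epsilon> < 1 \<and> 0 < d \<and> H \<subseteq> {..<d} \<and>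
        vhead \<in> Rd d \<and> (\<forall>i. i \<notin> H \<longrightarrow> vhead i = 0) \<and>
        set_pmf D \<subseteq> cube d \<times> {-1, 1} \<and>
        map_pmf fst D = pmf_of_set (cube d)
        \<longrightarrow>
        (\<exists>T :: nat. real T \<le> poly p (real d / \<epsilon>) \<and>
           (\<forall>cfg \<in> set_pmf (run FindRegularCoefficients \<epsilon> d H vhead \<tau> D T). halted cfg) \<and>
           measure_pmf.prob (run FindRegularCoefficients \<epsilon> d H vhead \<tau> D T)
             {cfg. ereal (err D (\<lambda>x. dotp d (out_vec d cfg) x + \<tau>))
                   \<le> ereal C * (opt_reg d H \<epsilon> vhead \<tau> D / ereal \<epsilon> * ereal (ln (1 / \<epsilon>)) + ereal \<epsilon>)}
             \<ge> 0.995))"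
proof (intro exI[of _ learner] exI[of _ "monom 115 5"] exI[of _ err_const] conjI allI impI)
  show C: "0 < err_const" using err_const_ge by linarith
  fix \<epsilon> :: real and d :: nat and H :: "nat set" and vhead :: "nat \<Rightarrow> real" and \<tau> :: real
    and D :: "((nat \<Rightarrow> real) \<times> real) pmf"
  assume "0 < \<epsilon> \<and> \<epsilon> < 1 \<and> 0 < d \<and> H \<subseteq> {..<d} \<and>
        vhead \<in> Rd d \<and> (\<forall>i. i \<notin> H \<longrightarrow> vhead i = 0) \<and>
        set_pmf D \<subseteq> cube d \<times> {-1, 1} \<and> map_pmf fst D = pmf_of_set (cube d)"
  then have \<epsilon>: "0 < \<epsilon>" "\<epsilon> < 1" and d: "0 < d" and vhead: "\<And>i. i \<notin> H \<Longrightarrow> vhead i = 0"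
    and supp: "set_pmf D \<subseteq> cube d \<times> {-1, 1}" and uniform: "map_pmf fst D = pmf_of_set (cube d)"
    by auto
  let ?good = "\<lambda>e. ereal e \<le> ereal err_const * (opt_reg d H \<epsilon> vhead \<tau> D / ereal \<epsilon> * ereal (ln (1 / \<epsilon>)) + ereal \<epsilon>)"
  let ?err = "\<lambda>s. err D (\<lambda>x. dotp d (arr s 3) x + \<tau>)"
  \<comment> \<open>The comparator \<open>0\<close> yields the running time even if there is no regular vector.\<close>
  interpret zero: noisy_halfspace \<epsilon> d vhead \<tau> D "\<lambda>_. 0"
    by unfold_locales (use \<epsilon> d supp in auto)
  let ?T = "zero.bandwidth * 5 + zero.rounds * (d * 18 + 28) + (d * 4 + 9)"
  have ln0: "0 < ln (1 / \<epsilon>)" using \<epsilon> by simp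
  have halts: "halts_with D ?T ([learner], init_state \<epsilon> d H vhead \<tau>) (\<lambda>s. \<not> ?good (?err s)) (1 / 200)"
  \<comment> \<open>Outside this case the claimed bound is at least 1, hence met by every error
    probability.\<close>
  proof (cases "regular_vecs d H \<epsilon> \<noteq> {} \<and> \<epsilon> \<le> 1 / 2")
    case True
    then obtain v where v: "v \<in> regular_vecs d H \<epsilon>"
      and opt: "opt_reg d H \<epsilon> vhead \<tau> D = ereal (err D (\<lambda>x. dotp d vhead x + dotp d v x + \<tau>))"
      using opt_reg_attained[OF supp] by blast
    interpret regular_halfspace \<epsilon> d vhead \<tau> D v
      by unfold_locales (use \<epsilon> d supp uniform vhead regular_vecs_D[OF v] in auto)
    have "?good e \<longleftrightarrow> e \<le> err_const * (opt / \<epsilon> * ln (1 / \<epsilon>) + \<epsilon>)" for e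
      using \<epsilon> unfolding opt opt_def by simp
    \<comment> \<open>Bandwidth and rounds depend only on \<epsilon> and \<open>d\<close>, so
      unfolding identifies those of the two comparators.\<close>
    then show ?thesis
      using learner_err[of H] True unfolding bandwidth_def zero.bandwidth_def rounds_def zero.rounds_def by simp
  next
    case False
    have "?good e" if "e \<le> 1" for e
    proof (cases "regular_vecs d H \<epsilon> = {}")
      case True
      then have "opt_reg d H \<epsilon> vhead \<tau> D = \<infinity>" by (simp add: opt_reg_def top_ereal_def)
      then show ?thesis using \<epsilon> C ln0 by simp
    next
      case nonempty: False
      then have "1 / 2 < \<epsilon>" using False by auto
      moreover have "2 \<le> err_const" using err_const_ge by linarith
      \<comment> \<open>The summand \<epsilon> alone, scaled by \<open>err_const\<close>, reaches
        1.\<close>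
      ultimately have "2 * (1 / 2) \<le> err_const * \<epsilon>" by (intro mult_mono) auto
      then have "ereal e \<le> ereal err_const * ereal \<epsilon>" using that by simp
      also have "\<dots> \<le> ereal err_const * (opt_reg d H \<epsilon> vhead \<tau> D / ereal \<epsilon> * ereal (ln (1 / \<epsilon>)) + ereal \<epsilon>)"
        using C \<epsilon> ln0 opt_reg_nonneg[of d H \<epsilon> vhead \<tau> D]
        by (intro ereal_mult_left_mono ereal_le_add_self2 mult_nonneg_nonneg) auto
      finally show ?thesis .
    qed
    then have "?good (?err s)" for s by (simp add: err_def)
    \<comment> \<open>As no outcome is bad, only halting remains to be supplied.\<close>
    then show ?thesis by (intro zero.learner_halts[OF order_refl]) simp
  qed
  let ?run = "run learner \<epsilon> d H vhead \<tau> D ?T"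
  have bad: "\<forall>cfg\<in>set_pmf ?run. halted cfg" "measure_pmf.prob ?run {cfg. \<not> ?good (?err (snd cfg))} \<le> 1 / 200"
    using halts by (auto simp: halts_with_def run_def)
  have out: "dotp d (out_vec d cfg) = dotp d (arr (snd cfg) 3)" for cfg
    by (intro ext dotp_cong) (simp add: out_vec_def)
  have "measure_pmf.prob ?run {cfg. ?good (err D (\<lambda>x. dotp d (out_vec d cfg) x + \<tau>))}
      = 1 - measure_pmf.prob ?run {cfg. \<not> ?good (?err (snd cfg))}"
    unfolding out by (subst measure_pmf.prob_compl[symmetric]) (auto simp: Compl_eq_Diff_UNIV[symmetric] Collect_neg_eq)
  then have "0.995 \<le> measure_pmf.prob ?run {cfg. ?good (err D (\<lambda>x. dotp d (out_vec d cfg) x + \<tau>))}"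
    using bad(2) by simp
  then show "\<exists>T :: nat. real T \<le> poly (monom 115 5) (real d / \<epsilon>) \<and>
      (\<forall>cfg \<in> set_pmf (run learner \<epsilon> d H vhead \<tau> D T). halted cfg) \<and>
      measure_pmf.prob (run learner \<epsilon> d H vhead \<tau> D T)
        {cfg. ?good (err D (\<lambda>x. dotp d (out_vec d cfg) x + \<tau>))} \<ge> 0.995"
    using zero.run_time bad(1) by blast
qed

end
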